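(* Assume $\alpha>C$. For each $N\ge 2$ let $\xi^N$ be a random configuration distributed with the unique invariant measure of the Fleming-Viot process with $N$ particles, and let $\eta^N(x)=\sum_{i=1}^N\mathbf 1\{\xi^N(i)=x\}$. Then there exists a probability measure $\nu$ on $\Lambda$ such that for all $x\in\Lambda$, $$\lim_{N\to\infty}\mathbb E\Bigl(\frac{\eta^{N}(x)}{N}-\nu(x)\Bigr)^2=0 .$$ Furthermore, $\nu$ is the unique quasi-stationary distribution for $Q$.
   Context: Let $\Lambda$ be a countable set, $0\notin\Lambda$, and let $(Z_t)_{t\ge 0}$ be a pure jump regular (non-explosive) continuous-time Markov process on $\Lambda\cup\{0\}$ with transition rates matrix $Q=(q(x,y))$ and transition probabilities $P_t(x,y)$, with $0$ absorbing: $q(0,x)=0$ for all $x\in\Lambda$. Convention: $q(x,x)=-\sum_{y\in(\Lambda\cup\{0\})\setminus\{x\}}q(x,y)$. Standing assumptions: $\bar q:=\sup_{x\in\Lambda}\sum_{y\in(\Lambda\cup\{0\})\setminus\{x\}}q(x,y)<\infty$; $P_t(x,y)>0$ for all $x,y\in\Lambda$ and $t>0$; the absorption time at $0$ is almost surely finite for every initial state. Ergodicity coefficient and maximal absorbing rate: $$\alpha:=\sum_{z\in\Lambda}\ \inf_{x\in\Lambda\setminus\{z\}}q(x,z),\qquad C:=\sup_{x\in\Lambda}q(x,0)$$ (with $\inf\emptyset=+\infty$). For a probability measure $\mu$ on $\Lambda$, let $$\varphi^\mu_t(x)=\frac{\sum_{y\in\Lambda}\mu(y)P_t(y,x)}{1-\sum_{y\in\Lambda}\mu(y)P_t(y,0)},\qquad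 x\in\Lambda,$$ be the law at time $t$ of the process started from $\mu$ and conditioned on non-absorption until time $t$. A quasi-stationary distribution for $Q$ is a probability measure $\nu$ on $\Lambda$ with $\varphi^\nu_t=\nu$ for all $t\ge 0$. Fleming-Viot process with $N\ge 2$ particles: the continuous-time Markov process $\xi_t=(\xi_t(1),\dots,\xi_t(N))$ on $\Lambda^{\{1,\dots,N\}}$ in which particles move independently with rates $Q$ until absorption, and a particle that is absorbed at $0$ instantaneously jumps to the position of one of the other $N-1$ particles chosen uniformly at random. Its generator is $$\mathcal L^N f(\xi)=\sum_{i=1}^N\ \sum_{y\in\Lambda\setminus\{\xi(i)\}}\Bigl[q(\xi(i),y)+q(\xi(i),0)\,\frac{\eta(\xi,y)}{N-1}\Bigr]\bigl(f(\xi^{i,y})-f(\xi)\bigr),$$ where $\xi^{i,y}(j)=y$ for $j=i$ and $\xi^{i,y}(j)=\xi(j)$ otherwise, and $\eta(\xi,y)=\sum_{i=1}^N\mathbf 1\{\xi(i)=y\}$. When $\alpha>0$ (in particular when $\alpha>C$), this process has a unique invariant probability measure for each $N$. *)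

theory Defs
  imports "HOL-Probability.Probability"
begin

section \<open>Continuous-time Markov processes on a countable state space\<close>

text \<open>Off-diagonal rates are nonnegative and summable, and each diagonal entry is minus the
  total exit rate. Transition probabilities are families of discrete laws:
  \<open>pmf (P t x) y\<close> is $P_t(x,y)$.\<close>

definition rate_matrix :: "'s set \<Rightarrow> ('s \<Rightarrow> 's \<Rightarrow> real) \<Rightarrow> bool" where
  "rate_matrix E q \<longleftrightarrow>
     (\<forall>x\<in>E. (\<forall>y\<in>E - {x}. 0 \<le> q x y) \<and> q x summable_on (E - {x}) \<and>
       q x x = - (\<Sum>\<^sub>\<infinity>y\<in>E - {x}. q x y))"

definition markov_semigroup :: "'s set \<Rightarrow> (real \<Rightarrow> 's \<Rightarrow> 's pmf) \<Rightarrow> bool" where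
  "markov_semigroup E P \<longleftrightarrow>
     (\<forall>t\<ge>0. \<forall>x\<in>E. set_pmf (P t x) \<subseteq> E) \<and>
     (\<forall>x\<in>E. P 0 x = return_pmf x) \<and>
     (\<forall>s\<ge>0. \<forall>t\<ge>0. \<forall>x\<in>E. P (s + t) x = bind_pmf (P s x) (P t))"

definition has_transition_rates ::
    "'s set \<Rightarrow> (real \<Rightarrow> 's \<Rightarrow> 's pmf) \<Rightarrow> ('s \<Rightarrow> 's \<Rightarrow> real) \<Rightarrow> bool" where
  "has_transition_rates E P q \<longleftrightarrow>
     (\<forall>x\<in>E. \<forall>y\<in>E. ((\<lambda>t. pmf (P t x) y) has_real_derivative q x y) (at 0 within {0..}))"

text \<open>A regular jump path: right-continuous and piecewise constant, with finitely many jumps in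
  bounded time. The times \<open>T n\<close> include all jump times but need not all be jumps, so
  that paths which stop moving are covered.\<close>

definition regular_jump_path :: "(real \<Rightarrow> 's) \<Rightarrow> bool" where
  "regular_jump_path z \<longleftrightarrow>
     (\<exists>T :: nat \<Rightarrow> real. T 0 = 0 \<and> strict_mono T \<and> filterlim T at_top sequentially \<and>
        (\<forall>n. \<forall>t\<in>{T n..<T (Suc n)}. z t = z (T n)))"

text \<open>\<open>M x\<close> is the law of the process started from \<open>x\<close>. The Markov property is stated through the
  finite-dimensional distributions; the case \<open>n = 0\<close> says that the process starts at \<open>x\<close>.\<close>

definition jump_markov_process ::
    "'s set \<Rightarrow> (real \<Rightarrow> 's \<Rightarrow> 's pmf) \<Rightarrow> ('s \<Rightarrow> 'w measure) \<Rightarrow> (real \<Rightarrow> 'w \<Rightarrow> 's) \<Rightarrow> bool" where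
  "jump_markov_process E P M Z \<longleftrightarrow> markov_semigroup E P \<and>
     (\<forall>x\<in>E. prob_space (M x) \<and>
       (\<forall>t\<ge>0. Z t \<in> M x \<rightarrow>\<^sub>M count_space E) \<and>
       (AE \<omega> in M x. regular_jump_path (\<lambda>t. Z t \<omega>)) \<and>
       (\<forall>(n::nat) (t::nat \<Rightarrow> real) (y::nat \<Rightarrow> 's).
          t 0 = 0 \<and> (\<forall>i<n. t i \<le> t (Suc i)) \<and> y 0 = x \<and> (\<forall>i\<le>n. y i \<in> E) \<longrightarrow>
          measure (M x) {\<omega> \<in> space (M x). \<forall>i\<le>n. Z (t i) \<omega> = y i} =
            (\<Prod>i<n. pmf (P (t (Suc i) - t i) (y i)) (y (Suc i)))))"

definition absorption_time :: "(real \<Rightarrow> 'w \<Rightarrow> 's) \<Rightarrow> 's \<Rightarrow> 'w \<Rightarrow> ereal" where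
  "absorption_time Z \<Delta> \<omega> = (INF t\<in>{t. 0 \<le> t \<and> Z t \<omega> = \<Delta>}. ereal t)"

section \<open>Absorbed processes and quasi-stationary distributions\<close>

text \<open>\<open>L\<close> is the set of transient states and \<open>\<Delta>\<close> the absorbing state. The following quantities are
  taken in \<^typ>\<open>ennreal\<close>, so that the infimum over the empty set is infinite and
  sums and suprema need no side conditions; only off-diagonal (nonnegative) rates occur.\<close>

definition max_exit_rate :: "'s set \<Rightarrow> 's \<Rightarrow> ('s \<Rightarrow> 's \<Rightarrow> real) \<Rightarrow> ennreal" where
  "max_exit_rate L \<Delta> q = (SUP x\<in>L. \<Sum>\<^sub>\<infinity>y\<in>insert \<Delta> L - {x}. ennreal (q x y))"

definition ergodicity_coeff :: "'s set \<Rightarrow> ('s \<Rightarrow> 's \<Rightarrow> real) \<Rightarrow> ennreal" where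
  "ergodicity_coeff L q = (\<Sum>\<^sub>\<infinity>z\<in>L. INF x\<in>L - {z}. ennreal (q x z))"

definition max_absorbing_rate :: "'s set \<Rightarrow> 's \<Rightarrow> ('s \<Rightarrow> 's \<Rightarrow> real) \<Rightarrow> ennreal" where
  "max_absorbing_rate L \<Delta> q = (SUP x\<in>L. ennreal (q x \<Delta>))"

definition conditioned_law ::
    "'s set \<Rightarrow> 's \<Rightarrow> (real \<Rightarrow> 's \<Rightarrow> 's pmf) \<Rightarrow> 's pmf \<Rightarrow> real \<Rightarrow> 's \<Rightarrow> real" where
  "conditioned_law L \<Delta> P \<mu> t x =
     (\<Sum>\<^sub>\<infinity>y\<in>L. pmf \<mu> y * pmf (P t y) x) / (1 - (\<Sum>\<^sub>\<infinity>y\<in>L. pmf \<mu> y * pmf (P t y) \<Delta>))"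

definition quasi_stationary ::
    "'s set \<Rightarrow> 's \<Rightarrow> (real \<Rightarrow> 's \<Rightarrow> 's pmf) \<Rightarrow> 's pmf \<Rightarrow> bool" where
  "quasi_stationary L \<Delta> P \<nu> \<longleftrightarrow>
     set_pmf \<nu> \<subseteq> L \<and> (\<forall>t\<ge>0. \<forall>x\<in>L. conditioned_law L \<Delta> P \<nu> t x = pmf \<nu> x)"

section \<open>The Fleming--Viot particle process\<close>

definition configs :: "'s set \<Rightarrow> nat \<Rightarrow> (nat \<Rightarrow> 's) set" where
  "configs L N = {1..N} \<rightarrow>\<^sub>E L"

definition occupation :: "nat \<Rightarrow> (nat \<Rightarrow> 's) \<Rightarrow> 's \<Rightarrow> nat" where
  "occupation N \<xi> y = card {i \<in> {1..N}. \<xi> i = y}"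

definition fv_generator ::
    "'s set \<Rightarrow> 's \<Rightarrow> ('s \<Rightarrow> 's \<Rightarrow> real) \<Rightarrow> nat \<Rightarrow> ((nat \<Rightarrow> 's) \<Rightarrow> real) \<Rightarrow> (nat \<Rightarrow> 's) \<Rightarrow> real" where
  "fv_generator L \<Delta> q N f \<xi> =
     (\<Sum>i=1..N. \<Sum>\<^sub>\<infinity>y\<in>L - {\<xi> i}.
        (q (\<xi> i) y + q (\<xi> i) \<Delta> * (real (occupation N \<xi> y) / (real N - 1))) *
        (f (\<xi>(i := y)) - f \<xi>))"

text \<open>The transition semigroup \<open>S\<close> of the process with generator \<^const>\<open>fv_generator\<close>, tested
  against all bounded functions. As the jump rates are bounded, this determines \<open>S\<close> on
  \<^term>\<open>configs L N\<close>.\<close>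

definition fv_semigroup ::
    "'s set \<Rightarrow> 's \<Rightarrow> ('s \<Rightarrow> 's \<Rightarrow> real) \<Rightarrow> nat \<Rightarrow>
      (real \<Rightarrow> (nat \<Rightarrow> 's) \<Rightarrow> (nat \<Rightarrow> 's) pmf) \<Rightarrow> bool" where
  "fv_semigroup L \<Delta> q N S \<longleftrightarrow> markov_semigroup (configs L N) S \<and>
     (\<forall>f :: (nat \<Rightarrow> 's) \<Rightarrow> real. bounded (range f) \<longrightarrow>
       (\<forall>\<xi>\<in>configs L N.
         ((\<lambda>t. measure_pmf.expectation (S t \<xi>) f) has_real_derivative fv_generator L \<Delta> q N f \<xi>)
           (at 0 within {0..})))"

definition invariant_law :: "'s set \<Rightarrow> (real \<Rightarrow> 's \<Rightarrow> 's pmf) \<Rightarrow> 's pmf \<Rightarrow> bool" where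
  "invariant_law E P \<rho> \<longleftrightarrow> set_pmf \<rho> \<subseteq> E \<and> (\<forall>t\<ge>0. bind_pmf \<rho> (P t) = \<rho>)"

end

theory Submission
  imports Defs
begin

text \<open>
  Write \<open>F \<mu>\<close> for the law obtained from \<open>\<mu>\<close> by one small time step of the killed chain in which a
  particle that gets killed is replaced by a fresh sample of \<open>\<mu>\<close> itself. With \<open>J = I + \<delta> Q\<close> as the
  step of the chain, \<open>F \<mu> = \<mu> J\<close> on \<open>L\<close> plus \<open>\<mu>(J(\<cdot>, \<Delta>)) \<mu>\<close>, so \<open>F \<nu> = \<nu>\<close> says \<open>\<nu> Q = - \<theta> \<nu>\<close> on
  \<open>L\<close> with \<open>\<theta>\<close> the mean killing rate under \<open>\<nu>\<close>: these are exactly the quasi-stationary laws.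
  One direction is differentiation at time zero; conversely, boundedness of the rates turns the equation at
  time zero into \<open>\<nu> P\<^sub>t = exp (- \<theta> t) \<nu>\<close> on \<open>L\<close>.

  The whole theorem rests on one inequality (\<open>reinject_diff_le\<close>). A minorant \<open>a(z) \<le> q(x,z)\<close> of total
  mass \<open>\<alpha>\<close> lets two chains forget their starting points at rate \<open>\<alpha>\<close>, while reinjection at two
  different laws can separate them at rate at most \<open>C\<close>. Hence \<open>F\<close> contracts total variation by the
  factor \<open>1 - \<delta> (\<alpha> - C)\<close>. Banach iteration gives a unique fixed point \<open>\<nu>\<close>, which is therefore the
  unique quasi-stationary law.

  The same inequality controls the particle system. For a test function \<open>s\<close> with values in \<open>[0,1]\<close> that
  nearly attains the total variation distance between \<open>\<nu>\<close> and \<open>\<mu>\<close>, one step of \<open>F\<close> raises \<open>\<mu>(s)\<close>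
  by almost \<open>\<delta> (\<alpha> - C)\<close> times that distance (\<open>drift_towards_fixed_point\<close>). The Fleming--Viot generator
  moves the empirical measure by \<open>F\<close>, up to an error of order \<open>1/N\<close>: a killed particle samples from
  the other \<open>N - 1\<close> particles rather than from all \<open>N\<close>. The Lyapunov function is a smoothed version
  of \<open>\<Sum>\<^sub>z (\<nu>(z) - \<pi>(z))\<^sup>+\<close>, which equals the distance between \<open>\<nu>\<close> and the empirical measure \<open>\<pi>\<close>. The
  one-sided form is what makes infinite \<open>L\<close> harmless: the sites outside a finite set \<open>A\<close> contribute
  at most \<open>\<nu>(L - A)\<close>, so no uniform tightness of the particle system has to be shown. Smoothing at scale
  \<open>\<epsilon>\<close> makes the second-order effect of the jumps, which have size \<open>1/N\<close>, at most of order \<open>1/(\<epsilon> N)\<close>.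
  As the generator has mean zero under the invariant law, the expected distance is bounded by a multiple of
  \<open>\<epsilon> |A| + \<nu>(L - A) + (1 + 1/\<epsilon>)/N\<close> (\<open>invariant_tv_le\<close>), which can be made arbitrarily small. Convergence in
  mean of the distance, which is at most 1, is stronger than the mean-square convergence at each site.
\<close>

section \<open>Expectations under discrete laws\<close>

abbreviation (input) expect :: "'a pmf \<Rightarrow> ('a \<Rightarrow> real) \<Rightarrow> real" where
  "expect p f \<equiv> measure_pmf.expectation p f"

lemma integrable_pmf_bounded:
  fixes f :: "'a \<Rightarrow> real"
  assumes "\<And>x. \<bar>f x\<bar> \<le> B"
  shows "integrable (measure_pmf p) f"
  by (rule measure_pmf.integrable_const_bound[where B = B]) (use assms in auto)

lemma expect_bounds:
  assumes "\<And>x. x \<in> set_pmf p \<Longrightarrow> a \<le> f x" "\<And>x. x \<in> set_pmf p \<Longrightarrow> f x \<le> b"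
  shows "a \<le> expect p f" "expect p f \<le> b"
proof -
  have "integrable (measure_pmf p) f"
    by (rule measure_pmf.integrable_const_bound[where B = "max \<bar>a\<bar> \<bar>b\<bar>"])
       (use assms in \<open>fastforce simp: AE_measure_pmf_iff\<close>)+
  then show "a \<le> expect p f" "expect p f \<le> b"
    using assms by (auto intro!: measure_pmf.integral_ge_const measure_pmf.integral_le_const
        simp: AE_measure_pmf_iff)
qed

lemma abs_expect_le:
  assumes "\<And>x. \<bar>f x\<bar> \<le> B"
  shows "\<bar>expect p f\<bar> \<le> B"
  using expect_bounds[of p "-B" f B] assms by (auto simp: abs_le_iff minus_le_iff)

lemma expect_cong:
  assumes "\<And>x. x \<in> set_pmf p \<Longrightarrow> f x = g x"
  shows "expect p f = expect p g"
  by (intro integral_cong_AE) (auto simp: AE_measure_pmf_iff assms)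

lemma expect_bind:
  assumes "\<And>x. \<bar>f x\<bar> \<le> B"
  shows "expect (bind_pmf p K) f = expect p (\<lambda>x. expect (K x) f)"
  unfolding measure_pmf_bind
  by (rule integral_bind[where K = "count_space UNIV" and B = B and B' = 1])
     (use assms in \<open>auto intro!: prob_space_imp_subprob_space measure_pmf.prob_space_axioms
        measure_pmf.finite_measure simp: space_subprob_algebra measure_pmf.emeasure_eq_measure\<close>)

lemma pmf_count_space_integral:
  fixes f :: "'a \<Rightarrow> real"
  assumes "\<And>x. \<bar>f x\<bar> \<le> B"
  shows "integrable (count_space UNIV) (\<lambda>x. pmf p x * f x)"
    and "expect p f = (\<integral>x. pmf p x * f x \<partial>count_space UNIV)"
  using integrable_pmf_bounded[OF assms, of p] unfolding measure_pmf_eq_density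
  by (simp_all add: integral_density integrable_density)

lemma infsum_pmf_eq_expect:
  fixes f :: "'a \<Rightarrow> real"
  assumes "set_pmf p \<subseteq> A" "\<And>x. \<bar>f x\<bar> \<le> B"
  shows "(\<lambda>x. pmf p x * f x) summable_on A" "(\<Sum>\<^sub>\<infinity>x\<in>A. pmf p x * f x) = expect p f"
proof -
  have 0: "pmf p x * f x = 0" if "x \<notin> A" for x
    using that assms(1) by (auto simp: pmf_eq_0_set_pmf)
  have i: "Infinite_Set_Sum.abs_summable_on (\<lambda>x. pmf p x * f x) UNIV"
    unfolding abs_summable_on_def by (rule pmf_count_space_integral[OF assms(2)])
  then have s: "(\<lambda>x. pmf p x * f x) summable_on UNIV"
    using abs_summable_equivalent abs_summable_summable by blast
  show "(\<lambda>x. pmf p x * f x) summable_on A"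
    using s by (rule summable_on_subset_banach) simp
  have "(\<Sum>\<^sub>\<infinity>x\<in>A. pmf p x * f x) = (\<Sum>\<^sub>\<infinity>x. pmf p x * f x)"
    by (rule infsum_cong_neutral) (use 0 in auto)
  also have "\<dots> = expect p f"
    using infsetsum_infsum[OF i] pmf_count_space_integral(2)[OF assms(2), of p]
    by (simp add: infsetsum_def)
  finally show "(\<Sum>\<^sub>\<infinity>x\<in>A. pmf p x * f x) = expect p f" .
qed

lemma pmf_of_has_sum_1:
  fixes f :: "'a \<Rightarrow> real"
  assumes "\<And>x. 0 \<le> f x" "(f has_sum 1) UNIV"
  shows "\<exists>p. pmf p = f"
proof -
  have "f summable_on UNIV"
    using assms(2) by (rule has_sum_imp_summable)
  then have "(\<lambda>x. norm (f x)) summable_on UNIV"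
    using assms(1) by simp
  then have a: "Infinite_Set_Sum.abs_summable_on f UNIV"
    by (subst abs_summable_equivalent[symmetric])
  have "(\<integral>\<^sup>+ x. ennreal (f x) \<partial>count_space UNIV) = ennreal (infsetsum f UNIV)"
    by (rule nn_integral_conv_infsetsum[OF a]) (use assms in auto)
  also have "infsetsum f UNIV = 1"
    using infsetsum_infsum[OF a] assms(2) by (simp add: infsumI)
  finally have "pmf (embed_pmf f) = f"
    using assms(1) by (intro ext pmf_embed_pmf) auto
  then show ?thesis by blast
qed

lemma set_pmf_subset_if_measure_1:
  assumes "measure (measure_pmf p) A = 1" shows "set_pmf p \<subseteq> A"
  using assms by (simp add: measure_pmf.prob_eq_1 AE_measure_pmf_iff subset_iff)

text \<open>Inner regularity of a discrete law with respect to finite sets.\<close>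

lemma finite_measure_approx:
  fixes p :: "'a pmf"
  assumes "0 < e"
  obtains B where "finite B" "B \<subseteq> A" "measure (measure_pmf p) A - e < measure (measure_pmf p) B"
proof -
  have s: "pmf p summable_on A" "(\<Sum>\<^sub>\<infinity>x\<in>A. pmf p x) = measure (measure_pmf p) A"
  proof -
    have i: "Infinite_Set_Sum.abs_summable_on (pmf p) A"
      unfolding abs_summable_on_def by (rule integrable_pmf)
    then show "pmf p summable_on A"
      using abs_summable_equivalent abs_summable_summable by blast
    show "(\<Sum>\<^sub>\<infinity>x\<in>A. pmf p x) = measure (measure_pmf p) A"
      using infsetsum_infsum[OF i] by (simp add: measure_pmf_conv_infsetsum)
  qed
  then have "((\<lambda>B. sum (pmf p) B) \<longlongrightarrow> measure (measure_pmf p) A) (finite_subsets_at_top A)"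
    using has_sum_infsum[OF s(1)] by (simp add: has_sum_def)
  then have "\<forall>\<^sub>F B in finite_subsets_at_top A. measure (measure_pmf p) A - e < sum (pmf p) B"
    using assms by (intro order_tendstoD) auto
  moreover have "\<forall>\<^sub>F B in finite_subsets_at_top A. finite B \<and> B \<subseteq> A"
    by (rule eventually_finite_subsets_at_top_weakI) auto
  ultimately have "\<forall>\<^sub>F B in finite_subsets_at_top A.
      finite B \<and> B \<subseteq> A \<and> measure (measure_pmf p) A - e < sum (pmf p) B"
    by eventually_elim auto
  from eventually_happens'[OF finite_subsets_at_top_neq_bot this]
  obtain B where "finite B" "B \<subseteq> A" "measure (measure_pmf p) A - e < sum (pmf p) B"
    by auto
  then show thesis
    by (intro that) (auto simp: measure_measure_pmf_finite)
qed

section \<open>Total variation distance\<close>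

text \<open>The difference is evaluated at the set where it is largest. Unlike the usual
  \<open>\<ell>\<^sup>1\<close> formula this needs no infinite sum.\<close>

definition tv :: "'a pmf \<Rightarrow> 'a pmf \<Rightarrow> real" where
  "tv p r = (let B = {x. pmf r x < pmf p x} in
     measure (measure_pmf p) B - measure (measure_pmf r) B)"

text \<open>The form of duality used throughout. Only the values of \<open>f\<close> on the two supports matter, and an
  additive constant in \<open>f\<close> does not change the left-hand side; subtracting as large a constant as
  possible before applying the lemma is how a minorant turns into a contraction.\<close>

lemma expect_diff_le_tv:
  fixes f :: "'a \<Rightarrow> real"
  assumes "\<And>x. x \<in> set_pmf p \<union> set_pmf r \<Longrightarrow> 0 \<le> f x"
    and "\<And>x. x \<in> set_pmf p \<union> set_pmf r \<Longrightarrow> f x \<le> c"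
  shows "expect p f - expect r f \<le> c * tv p r"
proof -
  define B where "B = {x. pmf r x < pmf p x}"
  define g where "g x = (if x \<in> set_pmf p \<union> set_pmf r then f x else 0)" for x
  obtain x0 where "x0 \<in> set_pmf p" using set_pmf_not_empty by fast
  then have c: "0 \<le> c" using assms[of x0] by auto
  have g: "\<bar>g x\<bar> \<le> c" for x using assms[of x] c by (auto simp: g_def)
  have b: "\<bar>c * indicator B x\<bar> \<le> c" for x using c by (auto simp: indicator_def)
  have "expect p f - expect r f = expect p g - expect r g"
    by (auto intro!: arg_cong2[where f = "(-)"] expect_cong simp: g_def)
  also have "\<dots> = (\<integral>x. pmf p x * g x - pmf r x * g x \<partial>count_space UNIV)"
    by (simp add: pmf_count_space_integral(2)[OF g] pmf_count_space_integral(1)[OF g]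
        Bochner_Integration.integral_diff)
  also have "\<dots> \<le> (\<integral>x. pmf p x * (c * indicator B x) - pmf r x * (c * indicator B x) \<partial>count_space UNIV)"
  proof (intro integral_mono Bochner_Integration.integrable_diff pmf_count_space_integral(1)[OF g]
      pmf_count_space_integral(1)[OF b])
    fix x
    show "pmf p x * g x - pmf r x * g x \<le> pmf p x * (c * indicator B x) - pmf r x * (c * indicator B x)"
    proof (cases "x \<in> B")
      case True
      then have "(pmf p x - pmf r x) * g x \<le> (pmf p x - pmf r x) * c"
        using g[of x] by (intro mult_left_mono) (auto simp: B_def)
      then show ?thesis using True by (simp add: algebra_simps)
    next
      case False
      then have "(pmf p x - pmf r x) * g x \<le> 0"
        using assms(1)[of x] by (intro mult_nonpos_nonneg) (auto simp: B_def g_def)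
      then show ?thesis using False by (simp add: algebra_simps)
    qed
  qed
  also have "\<dots> = expect p (\<lambda>x. c * indicator B x) - expect r (\<lambda>x. c * indicator B x)"
    by (simp add: pmf_count_space_integral(2)[OF b] pmf_count_space_integral(1)[OF b]
        Bochner_Integration.integral_diff del: Bochner_Integration.integral_mult_right_zero)
  also have "\<dots> = c * tv p r"
    by (simp add: tv_def B_def Let_def algebra_simps)
  finally show ?thesis .
qed

lemma measure_diff_le_tv: "measure (measure_pmf p) A - measure (measure_pmf r) A \<le> tv p r"
  using expect_diff_le_tv[of p r "indicator A" 1] by (simp add: indicator_def)

lemma tv_nonneg: "0 \<le> tv p r"
  using measure_diff_le_tv[of p "{}" r] by simp

lemma tv_le_1: "tv p r \<le> 1"
  unfolding tv_def Let_def by (smt (verit) measure_nonneg measure_pmf.prob_le_1)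

lemma tv_eq_0D: assumes "tv p r = 0" shows "p = r"
proof (rule ccontr)
  assume "p \<noteq> r"
  then obtain x where "pmf r x < pmf p x"
    using pmf_neq_exists_less[of r p] by auto
  with measure_diff_le_tv[of p "{x}" r] assms show False
    by (simp add: measure_pmf_single)
qed

lemma abs_measure_diff_le_tv: "\<bar>measure (measure_pmf p) A - measure (measure_pmf r) A\<bar> \<le> tv p r"
proof -
  have compl: "measure (measure_pmf q) (UNIV - A) = 1 - measure (measure_pmf q) A"
    for q :: "'a pmf" using measure_pmf.prob_compl[of A q] by simp
  show ?thesis
    using measure_diff_le_tv[of p A r] measure_diff_le_tv[of p "UNIV - A" r]
    unfolding compl by linarith
qed

lemma abs_pmf_diff_le_tv: "\<bar>pmf p x - pmf r x\<bar> \<le> tv p r"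
  using abs_measure_diff_le_tv[of p "{x}" r] by (simp add: measure_pmf_single)

lemma tv_triangle: "tv p s \<le> tv p r + tv r s"
proof -
  define B where "B = {x. pmf s x < pmf p x}"
  show ?thesis
    using measure_diff_le_tv[of p B r] measure_diff_le_tv[of r B s]
    unfolding tv_def[of p s] Let_def B_def[symmetric] by linarith
qed

lemma tv_commute: "tv p r = tv r p"
proof -
  have "tv p r \<le> tv r p" for p r :: "'a pmf"
    using abs_measure_diff_le_tv[of r "{x. pmf r x < pmf p x}" p] by (simp add: tv_def Let_def)
  then show ?thesis by (meson antisym)
qed

lemma tv_complete:
  fixes p :: "nat \<Rightarrow> 'a pmf"
  assumes cauchy: "\<And>e. 0 < e \<Longrightarrow> \<exists>N. \<forall>m\<ge>N. \<forall>n\<ge>N. tv (p m) (p n) < e"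
  obtains r where "(\<lambda>n. tv r (p n)) \<longlonglongrightarrow> 0"
proof -
  have "Cauchy (\<lambda>n. pmf (p n) x)" for x
    unfolding Cauchy_def dist_real_def using cauchy abs_pmf_diff_le_tv
    by (meson le_less_trans)
  then have "convergent (\<lambda>n. pmf (p n) x)" for x
    by (simp add: Cauchy_convergent)
  then obtain f where f: "\<And>x. (\<lambda>n. pmf (p n) x) \<longlonglongrightarrow> f x"
    unfolding convergent_def by metis
  have fB: "(\<lambda>n. measure (p n) B) \<longlonglongrightarrow> sum f B" if "finite B" for B
    using tendsto_sum[of B "\<lambda>x n. pmf (p n) x" f sequentially] f that
    by (simp add: measure_measure_pmf_finite)
  have close: "\<bar>sum f B - measure (p n) B\<bar> \<le> e"
    if "finite B" "\<forall>m\<ge>N. tv (p m) (p n) < e" for B n N e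
  proof (rule LIMSEQ_le_const2)
    show "(\<lambda>m. \<bar>measure (p m) B - measure (p n) B\<bar>) \<longlonglongrightarrow> \<bar>sum f B - measure (p n) B\<bar>"
      by (intro tendsto_intros fB that)
    show "\<exists>N. \<forall>m\<ge>N. \<bar>measure (p m) B - measure (p n) B\<bar> \<le> e"
      using that(2) abs_measure_diff_le_tv by (meson le_less_trans less_imp_le)
  qed
  have f0: "0 \<le> f x" for x
    by (rule LIMSEQ_le_const[OF f]) simp
  \<comment> \<open>No mass escapes: a finite set carrying most of one late term carries most of all later ones.\<close>
  have "(f has_sum 1) UNIV"
    unfolding has_sum_def tendsto_iff eventually_finite_subsets_at_top
  proof (intro allI impI)
    fix e :: real assume e: "e > 0"
    then obtain N where N: "\<forall>m\<ge>N. \<forall>n\<ge>N. tv (p m) (p n) < e/3" using cauchy[of "e/3"] by auto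
    obtain A where A: "finite A" "measure (p N) UNIV - e/3 < measure (p N) A"
      using finite_measure_approx[of "e/3" UNIV "p N"] e by auto
    show "\<exists>X. finite X \<and> X \<subseteq> UNIV \<and> (\<forall>Y. finite Y \<and> X \<subseteq> Y \<and> Y \<subseteq> UNIV \<longrightarrow> dist (sum f Y) 1 < e)"
    proof (intro exI[of _ A] conjI allI impI)
      fix Y assume Y: "finite Y \<and> A \<subseteq> Y \<and> Y \<subseteq> UNIV"
      have "\<bar>sum f Y - measure (p N) Y\<bar> \<le> e/3" using Y N by (intro close) auto
      moreover have "measure (p N) A \<le> measure (p N) Y" "measure (p N) Y \<le> 1"
        using Y by (auto intro!: measure_pmf.finite_measure_mono)
      moreover have "1 - e/3 < measure (p N) A" using A by simp
      ultimately show "dist (sum f Y) 1 < e" using e unfolding dist_real_def by argo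
    qed (use A in auto)
  qed
  then obtain r where r: "pmf r = f" using pmf_of_has_sum_1 f0 by blast
  have "(\<lambda>n. tv r (p n)) \<longlonglongrightarrow> 0"
  proof (rule LIMSEQ_I)
    fix e :: real assume e: "e > 0"
    then obtain N where N: "\<forall>m\<ge>N. \<forall>n\<ge>N. tv (p m) (p n) < e/3" using cauchy[of "e/3"] by auto
    show "\<exists>no. \<forall>n\<ge>no. norm (tv r (p n) - 0) < e"
    proof (intro exI[of _ N] allI impI)
      fix n assume n: "n \<ge> N"
      define A where "A = {x. pmf (p n) x < pmf r x}"
      obtain B where B: "finite B" "B \<subseteq> A" "measure r A - e/3 < measure r B"
        using finite_measure_approx[of "e/3" A r] e by auto
      have "\<bar>sum f B - measure (p n) B\<bar> \<le> e/3" using N n B by (intro close) auto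
      moreover have "measure (p n) B \<le> measure (p n) A"
        using B by (auto intro!: measure_pmf.finite_measure_mono)
      moreover have "measure r B = sum f B" using B r by (simp add: measure_measure_pmf_finite)
      ultimately have "tv r (p n) < e"
        using B e unfolding tv_def Let_def A_def[symmetric] by argo
      then show "norm (tv r (p n) - 0) < e" using tv_nonneg[of r "p n"] by simp
    qed
  qed
  then show thesis by (rule that)
qed

section \<open>Reinjection of an absorbed chain at its own law\<close>

text \<open>A discrete-time chain on \<open>L\<close> with one-step laws \<open>J x\<close> that may be killed by a jump to
  \<open>\<Delta>\<close>. The function \<open>b\<close> is a Doeblin minorant; its support \<open>F\<close> is finite so that its mass
  is a finite sum. The gap condition is the discrete-time form of \<open>\<alpha> > C\<close>.\<close>

locale absorbed_chain =
  fixes L :: "'s set" and \<Delta> :: 's and J :: "'s \<Rightarrow> 's pmf"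
    and F :: "'s set" and b :: "'s \<Rightarrow> real" and \<gamma> :: real
  assumes absorbing_notin: "\<Delta> \<notin> L" and nonempty: "L \<noteq> {}"
    and J_subset: "x \<in> L \<Longrightarrow> set_pmf (J x) \<subseteq> insert \<Delta> L"
    and F: "finite F" "F \<subseteq> L"
    and b_nonneg: "z \<in> F \<Longrightarrow> 0 \<le> b z"
    and minorised: "x \<in> L \<Longrightarrow> z \<in> F \<Longrightarrow> b z \<le> pmf (J x) z"
    and absorption_le: "x \<in> L \<Longrightarrow> pmf (J x) \<Delta> \<le> \<gamma>"
    and gap: "\<gamma> < sum b F"
begin

text \<open>One step from \<open>x\<close> in which a killed particle resumes at a sample of \<open>\<mu>\<close>. The mean-field chain uses
  its own law for \<open>\<mu>\<close>; a Fleming--Viot particle uses the empirical law of the other particles.\<close>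

definition redraw :: "'s pmf \<Rightarrow> 's \<Rightarrow> 's pmf" where
  "redraw \<mu> x = bind_pmf (J x) (\<lambda>y. if y = \<Delta> then \<mu> else return_pmf y)"

definition reinject :: "'s pmf \<Rightarrow> 's pmf" where
  "reinject \<mu> = bind_pmf \<mu> (redraw \<mu>)"

lemma set_redraw: "set_pmf \<mu> \<subseteq> L \<Longrightarrow> x \<in> L \<Longrightarrow> set_pmf (redraw \<mu> x) \<subseteq> L"
  using J_subset by (fastforce simp: redraw_def split: if_splits)

lemma set_reinject: "set_pmf \<mu> \<subseteq> L \<Longrightarrow> set_pmf (reinject \<mu>) \<subseteq> L"
  using set_redraw by (fastforce simp: reinject_def)

lemma expect_redraw:
  assumes s: "\<And>y. \<bar>s y\<bar> \<le> B"
  shows "expect (redraw \<mu> x) s =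
    expect (J x) (\<lambda>y. if y = \<Delta> then 0 else s y) + pmf (J x) \<Delta> * expect \<mu> s"
proof -
  have B: "0 \<le> B" using s[of undefined] by simp
  have "expect (redraw \<mu> x) s =
      expect (J x) (\<lambda>y. expect (if y = \<Delta> then \<mu> else return_pmf y) s)"
    unfolding redraw_def by (rule expect_bind[OF s])
  also have "\<dots> = expect (J x) (\<lambda>y. (if y = \<Delta> then 0 else s y) + indicator {\<Delta>} y * expect \<mu> s)"
    by (rule expect_cong) simp
  also have "\<dots> = expect (J x) (\<lambda>y. if y = \<Delta> then 0 else s y)
      + expect (J x) (\<lambda>y. indicator {\<Delta>} y * expect \<mu> s)"
    using s B by (intro Bochner_Integration.integral_add integrable_pmf_bounded[where B = B]
        integrable_pmf_bounded[where B = "\<bar>expect \<mu> s\<bar>"]) (auto simp: indicator_def)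
  also have "expect (J x) (\<lambda>y. indicator {\<Delta>} y * expect \<mu> s) = pmf (J x) \<Delta> * expect \<mu> s"
    by (simp add: measure_pmf_single)
  finally show ?thesis .
qed

lemma abs_expect_killed_le:
  assumes "\<And>y. \<bar>s y\<bar> \<le> B"
  shows "\<bar>expect (J x) (\<lambda>y. if y = \<Delta> then 0 else s y)\<bar> \<le> B"
  using order_trans[OF abs_ge_zero assms] assms by (intro abs_expect_le) auto

lemma expect_reinject:
  assumes s: "\<And>y. \<bar>s y\<bar> \<le> B"
  shows "expect (reinject \<mu>) s = expect \<mu> (\<lambda>x. expect (J x) (\<lambda>y. if y = \<Delta> then 0 else s y))
    + expect \<mu> (\<lambda>x. pmf (J x) \<Delta>) * expect \<mu> s"
proof -
  have "expect (reinject \<mu>) s = expect \<mu> (\<lambda>x.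
      expect (J x) (\<lambda>y. if y = \<Delta> then 0 else s y) + pmf (J x) \<Delta> * expect \<mu> s)"
    unfolding reinject_def by (simp add: expect_bind[OF s] expect_redraw[OF s])
  also have "\<dots> = expect \<mu> (\<lambda>x. expect (J x) (\<lambda>y. if y = \<Delta> then 0 else s y))
      + expect \<mu> (\<lambda>x. pmf (J x) \<Delta> * expect \<mu> s)"
    using abs_expect_le[OF s, of \<mu>]
    by (intro Bochner_Integration.integral_add integrable_pmf_bounded[OF abs_expect_killed_le[OF s]]
        integrable_pmf_bounded[where B = B])
       (auto simp: abs_mult intro: order_trans[OF mult_left_le_one_le] pmf_le_1)
  finally show ?thesis by simp
qed

text \<open>The comparison of measures \<open>b \<le> J x\<close>, tested against nonnegative functions.\<close>

lemma minorised_expect: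
  assumes f: "\<And>y. 0 \<le> f y" "\<And>y. f y \<le> B" and x: "x \<in> L"
  shows "(\<Sum>z\<in>F. b z * f z) \<le> expect (J x) f"
proof -
  have "(\<Sum>z\<in>F. b z * f z) \<le> (\<Sum>z\<in>F. (f z * indicator F z) * pmf (J x) z)"
    using f minorised[OF x] by (intro sum_mono) (auto simp: mult.commute[of "b _"] intro!: mult_left_mono)
  also have "\<dots> = expect (J x) (\<lambda>z. f z * indicator F z)"
    by (rule integral_measure_pmf_real[symmetric]) (use F in \<open>auto simp: indicator_def split: if_splits\<close>)
  also have "\<dots> \<le> expect (J x) f"
    using f order_trans[OF f] by (intro integral_mono integrable_pmf_bounded[where B = B])
      (auto simp: indicator_def)
  finally show ?thesis .
qed

lemma gamma_nonneg: "0 \<le> \<gamma>"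
  using absorption_le nonempty pmf_nonneg order_trans by (metis all_not_in_conv)

lemma minorant_le_1: "sum b F \<le> 1"
  using minorised_expect[of "\<lambda>_. 1" 1] nonempty by auto

lemma gamma_le_1: "\<gamma> \<le> 1"
  using gap minorant_le_1 by linarith

lemma expect_absorption:
  assumes "set_pmf \<mu> \<subseteq> L"
  shows "0 \<le> expect \<mu> (\<lambda>x. pmf (J x) \<Delta>)" "expect \<mu> (\<lambda>x. pmf (J x) \<Delta>) \<le> \<gamma>"
  using assms absorption_le by (intro expect_bounds[where b = 1] expect_bounds[where a = 0];
      auto simp: pmf_le_1)+

text \<open>The key inequality. Both the nonlinear term and the minorant are absorbed into one test function:
  with \<open>m = \<Sum>\<^sub>z b(z) s(z)\<close> and \<open>p(x) = J(x, \<Delta>)\<close>, the function \<open>G(x) = (J s)(x) - m + p(x) \<nu>(s)\<close>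
  satisfies
  \<open>(F \<nu>)(s) - (F \<mu>)(s) = (\<nu>(G) - \<mu>(G)) + \<mu>(p) (\<nu>(s) - \<mu>(s))\<close>, and on \<open>L\<close> it takes values in
  \<open>[0, 1 - b(F)]\<close>. The lower bound holds because \<open>b\<close> minorises \<open>J x\<close> against \<open>s\<close>, the upper one because it
  minorises \<open>J x\<close> against \<open>1 - s\<close>. The last term is kept exact: with \<open>\<mu>(p) \<le> \<gamma>\<close> it gives the contraction
  as well as the drift below.\<close>

lemma reinject_diff_le:
  assumes \<nu>: "set_pmf \<nu> \<subseteq> L" and \<mu>: "set_pmf \<mu> \<subseteq> L"
    and s: "\<And>y. 0 \<le> s y" "\<And>y. s y \<le> 1"
  shows "expect (reinject \<nu>) s - expect (reinject \<mu>) s \<le>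
    (1 - sum b F) * tv \<nu> \<mu> + expect \<mu> (\<lambda>x. pmf (J x) \<Delta>) * (expect \<nu> s - expect \<mu> s)"
proof -
  define s0 where "s0 = (\<lambda>y. if y = \<Delta> then 0 else s y)"
  define Js where "Js x = expect (J x) s0" for x
  define p where "p x = pmf (J x) \<Delta>" for x
  define m where "m = (\<Sum>z\<in>F. b z * s z)"
  define G where "G x = Js x - m + p x * expect \<nu> s" for x
  have s1: "\<bar>s y\<bar> \<le> 1" for y using s[of y] by simp
  have s0F: "s0 z = s z" if "z \<in> F" for z
    using that F absorbing_notin by (auto simp: s0_def)
  have s01: "\<bar>s0 y\<bar> \<le> 1" for y using s1[of y] by (simp add: s0_def)
  have \<nu>s: "0 \<le> expect \<nu> s" "expect \<nu> s \<le> 1"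
    using expect_bounds[of \<nu> 0 s 1] s by auto
  have iJs: "integrable (measure_pmf q) Js" and ip: "integrable (measure_pmf q) p" for q
    using abs_expect_le[OF s01] by (auto intro!: integrable_pmf_bounded[where B = 1]
        simp: Js_def p_def pmf_le_1)
  have EG: "expect q G = expect q Js - m + expect q p * expect \<nu> s" for q
    unfolding G_def using iJs ip by simp
  have "0 \<le> G x" "G x \<le> 1 - sum b F" if x: "x \<in> L" for x
  proof -
    \<comment> \<open>The minorant does not charge \<open>\<Delta>\<close>, so killing \<open>s\<close> there loses nothing.\<close>
    have "m \<le> Js x"
      using minorised_expect[of s0 1 x] s x by (simp add: m_def Js_def s0F) (simp add: s0_def)
    then show "0 \<le> G x" using \<nu>s by (simp add: G_def p_def)
    \<comment> \<open>At \<open>\<Delta>\<close> the killed chain has the value \<open>\<nu>(s)\<close>, which is still at most 1.\<close>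
    define f where "f y = 1 - s0 y - indicator {\<Delta>} y * expect \<nu> s" for y
    have "(\<Sum>z\<in>F. b z * f z) \<le> expect (J x) f"
      using s \<nu>s x by (intro minorised_expect[of f 1]) (auto simp: f_def s0_def)
    also have "(\<Sum>z\<in>F. b z * f z) = (\<Sum>z\<in>F. b z - b z * s z)"
      by (intro sum.cong) (use F absorbing_notin in \<open>auto simp: f_def s0F algebra_simps indicator_def\<close>)
    also have "\<dots> = sum b F - m" by (simp add: sum_subtractf m_def)
    also have "expect (J x) f = 1 - Js x - p x * expect \<nu> s"
      unfolding f_def using integrable_pmf_bounded[OF s01, of "J x"]
      by (simp add: Js_def p_def measure_pmf_single integrable_pmf_bounded[where B = 1])
    finally show "G x \<le> 1 - sum b F" by (simp add: G_def)
  qed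
  then have "expect \<nu> G - expect \<mu> G \<le> (1 - sum b F) * tv \<nu> \<mu>"
    using \<nu> \<mu> by (intro expect_diff_le_tv) auto
  moreover have "expect (reinject q) s = expect q Js + expect q p * expect q s" for q
    unfolding expect_reinject[OF s1] Js_def p_def s0_def ..
  ultimately show ?thesis unfolding EG p_def[symmetric] by (simp add: algebra_simps)
qed

lemma tv_reinject_le:
  assumes "set_pmf \<nu> \<subseteq> L" "set_pmf \<mu> \<subseteq> L"
  shows "tv (reinject \<nu>) (reinject \<mu>) \<le> (1 - (sum b F - \<gamma>)) * tv \<nu> \<mu>"
proof -
  define A where "A = {x. pmf (reinject \<mu>) x < pmf (reinject \<nu>) x}"
  have "tv (reinject \<nu>) (reinject \<mu>)
      = expect (reinject \<nu>) (indicator A) - expect (reinject \<mu>) (indicator A)"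
    by (simp add: tv_def A_def Let_def)
  also have "\<dots> \<le> (1 - sum b F) * tv \<nu> \<mu>
      + expect \<mu> (\<lambda>x. pmf (J x) \<Delta>) * (expect \<nu> (indicator A) - expect \<mu> (indicator A))"
    by (rule reinject_diff_le) (use assms in \<open>auto simp: indicator_def\<close>)
  also have "expect \<mu> (\<lambda>x. pmf (J x) \<Delta>) * (expect \<nu> (indicator A) - expect \<mu> (indicator A))
      \<le> expect \<mu> (\<lambda>x. pmf (J x) \<Delta>) * tv \<nu> \<mu>"
    using expect_absorption[OF assms(2)] measure_diff_le_tv[of \<nu> A \<mu>]
    by (intro mult_left_mono) auto
  also have "\<dots> \<le> \<gamma> * tv \<nu> \<mu>"
    using expect_absorption[OF assms(2)] tv_nonneg by (intro mult_right_mono) auto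
  finally show ?thesis by (simp add: algebra_simps)
qed

lemma reinject_fixed_unique:
  assumes "set_pmf \<nu> \<subseteq> L" "set_pmf \<mu> \<subseteq> L" "reinject \<nu> = \<nu>" "reinject \<mu> = \<mu>"
  shows "\<nu> = \<mu>"
proof (rule tv_eq_0D)
  have "(sum b F - \<gamma>) * tv \<nu> \<mu> \<le> 0"
    using tv_reinject_le[OF assms(1,2)] assms(3,4) by (simp add: algebra_simps)
  then show "tv \<nu> \<mu> = 0"
    using gap tv_nonneg[of \<nu> \<mu>] by (simp add: mult_le_0_iff)
qed

text \<open>Banach iteration from a point mass: the iterates are Cauchy in total variation, and
  the limit inherits its support and the fixed point equation by continuity.\<close>

lemma reinject_fixed_exists: "\<exists>\<nu>. set_pmf \<nu> \<subseteq> L \<and> reinject \<nu> = \<nu>"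
proof -
  define c where "c = 1 - (sum b F - \<gamma>)"
  have c: "0 \<le> c" "c < 1" using gap minorant_le_1 gamma_nonneg by (auto simp: c_def)
  have sub: "set_pmf ((reinject ^^ n) \<mu>) \<subseteq> L" if "set_pmf \<mu> \<subseteq> L" for n \<mu>
    by (induction n) (use that set_reinject in auto)
  have iter: "tv ((reinject ^^ n) \<nu>) ((reinject ^^ n) \<mu>) \<le> c ^ n"
    if "set_pmf \<nu> \<subseteq> L" "set_pmf \<mu> \<subseteq> L" for n \<nu> \<mu>
  proof (induction n)
    case (Suc n)
    have "tv ((reinject ^^ Suc n) \<nu>) ((reinject ^^ Suc n) \<mu>)
        \<le> c * tv ((reinject ^^ n) \<nu>) ((reinject ^^ n) \<mu>)"
      using tv_reinject_le[OF sub[OF that(1)] sub[OF that(2)]] by (simp add: c_def)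
    also have "\<dots> \<le> c ^ Suc n" using Suc c by (simp add: mult_left_mono)
    finally show ?case .
  qed (simp add: tv_le_1)
  obtain x0 where x0: "x0 \<in> L" using nonempty by blast
  define p where "p n = (reinject ^^ n) (return_pmf x0)" for n
  have p: "set_pmf (p n) \<subseteq> L" for n using sub[of "return_pmf x0"] x0 by (simp add: p_def)
  have close: "tv (p (n + k)) (p n) \<le> c ^ n" for n k
    unfolding p_def funpow_add comp_def by (rule iter) (use sub x0 in auto)
  have "\<exists>N. \<forall>m\<ge>N. \<forall>n\<ge>N. tv (p m) (p n) < e" if e: "e > 0" for e
  proof -
    obtain N where N: "c ^ N < e / 2"
      using real_arch_pow_inv[of "e / 2" c] e c by auto
    have "tv (p m) (p n) < e" if "m \<ge> N" "n \<ge> N" for m n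
    proof -
      have "tv (p m) (p n) \<le> tv (p m) (p N) + tv (p n) (p N)"
        using tv_triangle[of "p m" "p n" "p N"] tv_commute by metis
      also have "\<dots> \<le> c ^ N + c ^ N"
        using close[of N "m - N"] close[of N "n - N"] that by simp
      finally show ?thesis using N by simp
    qed
    then show ?thesis by blast
  qed
  then obtain r where r: "(\<lambda>n. tv r (p n)) \<longlonglongrightarrow> 0" by (rule tv_complete)
  have "measure r L \<ge> 1"
  proof (rule LIMSEQ_le_const)
    show "(\<lambda>n. measure r L + tv r (p n)) \<longlonglongrightarrow> measure r L"
      using tendsto_add[OF tendsto_const r] by simp
    have "measure (p n) L = 1" for n
      using p by (subst measure_pmf.prob_eq_1) (auto simp: AE_measure_pmf_iff)
    then show "\<exists>N. \<forall>n\<ge>N. 1 \<le> measure r L + tv r (p n)"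
      using abs_measure_diff_le_tv[of r L] by (metis abs_diff_le_iff diff_le_eq add.commute)
  qed
  then have rL: "set_pmf r \<subseteq> L"
    by (intro set_pmf_subset_if_measure_1) (simp add: order_antisym)
  have "tv (reinject r) r \<le> 0"
  proof (rule LIMSEQ_le_const)
    show "(\<lambda>n. tv r (p n) + tv r (p (Suc n))) \<longlonglongrightarrow> 0"
      using tendsto_add[OF r LIMSEQ_Suc[OF r]] by simp
    have "tv (reinject r) r \<le> tv r (p n) + tv r (p (Suc n))" for n
    proof -
      have "tv (reinject r) r \<le> tv (reinject r) (reinject (p n)) + tv r (p (Suc n))"
        using tv_triangle[of "reinject r" r "p (Suc n)"] tv_commute by (metis p_def funpow.simps(2) comp_apply)
      also have "tv (reinject r) (reinject (p n)) \<le> c * tv r (p n)"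
        using tv_reinject_le[OF rL p] by (simp add: c_def)
      also have "\<dots> \<le> tv r (p n)"
        using c tv_nonneg by (intro mult_left_le_one_le) auto
      finally show ?thesis by simp
    qed
    then show "\<exists>N. \<forall>n\<ge>N. tv (reinject r) r \<le> tv r (p n) + tv r (p (Suc n))" by blast
  qed
  then have "reinject r = r" by (intro tv_eq_0D) (simp add: order_antisym tv_nonneg)
  with rL show ?thesis by blast
qed

text \<open>The counterpart of the contraction for a fixed test function: if \<open>s\<close> separates \<open>\<nu>\<close> from \<open>\<mu>\<close> optimally up to
  \<open>\<kappa>\<close>, then one step moves \<open>\<mu>(s)\<close> towards \<open>\<nu>(s)\<close> by the spectral gap times the distance, up to the
  same \<open>\<kappa>\<close>.\<close>

lemma drift_towards_fixed_point:
  assumes \<nu>: "set_pmf \<nu> \<subseteq> L" "reinject \<nu> = \<nu>" and \<mu>: "set_pmf \<mu> \<subseteq> L"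
    and s: "\<And>y. 0 \<le> s y" "\<And>y. s y \<le> 1"
    and near: "tv \<nu> \<mu> - \<kappa> \<le> expect \<nu> s - expect \<mu> s" and "0 \<le> \<kappa>"
  shows "(sum b F - \<gamma>) * tv \<nu> \<mu> - \<kappa> \<le> expect (reinject \<mu>) s - expect \<mu> s"
proof -
  define a where "a = expect \<mu> (\<lambda>x. pmf (J x) \<Delta>)"
  have a: "0 \<le> a" "a \<le> \<gamma>" using expect_absorption[OF \<mu>] by (auto simp: a_def)
  have "(1 - a) * (tv \<nu> \<mu> - \<kappa>) \<le> (1 - a) * (expect \<nu> s - expect \<mu> s)"
    using near a gamma_le_1 by (intro mult_left_mono) auto
  moreover have "expect \<nu> s - expect (reinject \<mu>) s \<le>
      (1 - sum b F) * tv \<nu> \<mu> + a * (expect \<nu> s - expect \<mu> s)"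
    using reinject_diff_le[OF \<nu>(1) \<mu> s] \<nu>(2) by (simp add: a_def)
  moreover have "a * tv \<nu> \<mu> \<le> \<gamma> * tv \<nu> \<mu>" "0 \<le> a * \<kappa>"
    using a tv_nonneg[of \<nu> \<mu>] \<open>0 \<le> \<kappa>\<close> by (auto intro: mult_right_mono)
  ultimately show ?thesis by (simp add: algebra_simps)
qed

lemma pmf_reinject:
  assumes "z \<in> L"
  shows "pmf (reinject \<mu>) z = expect \<mu> (\<lambda>x. pmf (J x) z) + expect \<mu> (\<lambda>x. pmf (J x) \<Delta>) * pmf \<mu> z"
proof -
  have "(\<lambda>y. if y = \<Delta> then 0 else indicator {z} y) = (indicator {z} :: 's \<Rightarrow> real)"
    using assms absorbing_notin by (auto simp: indicator_def)
  then show ?thesis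
    using expect_reinject[of "indicator {z}" 1 \<mu>] by (simp add: measure_pmf_single)
qed

text \<open>A fixed point is a left eigenvector of the killed chain; the eigenvalue is the one-step
  survival probability.\<close>

lemma reinject_fixed_iff:
  assumes "set_pmf \<mu> \<subseteq> L"
  shows "reinject \<mu> = \<mu> \<longleftrightarrow>
    (\<forall>z\<in>L. expect \<mu> (\<lambda>x. pmf (J x) z) = (1 - expect \<mu> (\<lambda>x. pmf (J x) \<Delta>)) * pmf \<mu> z)"
proof -
  have "reinject \<mu> = \<mu> \<longleftrightarrow> (\<forall>z\<in>L. pmf (reinject \<mu>) z = pmf \<mu> z)"
  proof safe
    assume *: "\<forall>z\<in>L. pmf (reinject \<mu>) z = pmf \<mu> z"
    show "reinject \<mu> = \<mu>"
    proof (rule pmf_eqI)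
      fix z show "pmf (reinject \<mu>) z = pmf \<mu> z"
      proof (cases "z \<in> L")
        case False
        then show ?thesis using assms set_reinject[OF assms] pmf_eq_0_set_pmf
          by (metis subsetD)
      qed (use * in simp)
    qed
  qed simp
  then show ?thesis by (simp add: pmf_reinject algebra_simps)
qed

end

section \<open>Holding probabilities of Markov semigroups\<close>

lemma right_derivative_sequentially:
  fixes g :: "real \<Rightarrow> real"
  assumes "(g has_real_derivative d) (at 0 within {0..})"
    and "\<And>n. 0 < \<tau> n" "\<tau> \<longlonglongrightarrow> 0"
  shows "(\<lambda>n. (g (\<tau> n) - g 0) / \<tau> n) \<longlonglongrightarrow> d"
proof -
  have "((\<lambda>y. (g y - g 0) / (y - 0)) \<longlongrightarrow> d) (at 0 within {0..})"
    using assms(1) unfolding has_field_derivative_iff .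
  moreover have "filterlim \<tau> (at 0 within {0..}) sequentially"
    unfolding filterlim_at using assms(2,3) by (auto intro!: always_eventually less_imp_le simp: less_imp_neq[symmetric])
  ultimately show ?thesis
    using filterlim_compose by force
qed

lemma pmf_change_le: "\<bar>pmf p y - indicator {x} y\<bar> \<le> 1 - pmf p x"
proof (cases "y = x")
  case False
  have "sum (pmf p) {x, y} \<le> 1"
    by (metis finite.emptyI finite.insertI measure_measure_pmf_finite measure_pmf.prob_le_1)
  then show ?thesis using False by simp
qed (simp add: pmf_le_1)

lemma expect_change_le:
  assumes f: "\<And>y. \<bar>f y\<bar> \<le> B"
  shows "\<bar>expect p f - f x\<bar> \<le> 2 * B * (1 - pmf p x)"
proof -
  have d: "\<bar>f y - f x\<bar> \<le> 2 * B" for y using f[of x] f[of y] by linarith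
  have "expect p f - f x = expect p (\<lambda>y. f y - f x)"
    using integrable_pmf_bounded[OF f, of p] by simp
  also have "\<bar>\<dots>\<bar> \<le> expect p (\<lambda>y. \<bar>f y - f x\<bar>)"
    by (rule integral_abs_bound)
  also have "\<dots> \<le> expect p (\<lambda>y. 2 * B * (1 - indicator {x} y))"
    using d order_trans[OF abs_ge_zero d]
    by (intro integral_mono integrable_pmf_bounded[where B = "2 * B"]) (auto simp: indicator_def)
  also have "\<dots> = 2 * B * (expect p (\<lambda>_. 1) - expect p (indicator {x}))"
    by (subst Bochner_Integration.integral_diff[symmetric])
      (auto intro: integrable_pmf_bounded[where B = 1] simp: indicator_def)
  also have "\<dots> = 2 * B * (1 - pmf p x)"
    by (simp add: measure_pmf_single)
  finally show ?thesis .
qed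

lemma holding_supermultiplicative:
  assumes S: "markov_semigroup E S" and x: "x \<in> E" and "0 \<le> s" "0 \<le> t"
  shows "pmf (S s x) x * pmf (S t x) x \<le> pmf (S (s + t) x) x"
proof -
  have "pmf (S s x) x * pmf (S t x) x = expect (S s x) (\<lambda>y. indicator {x} y * pmf (S t x) x)"
    by (simp add: measure_pmf_single)
  also have "\<dots> \<le> expect (S s x) (\<lambda>y. pmf (S t y) x)"
    by (intro integral_mono integrable_pmf_bounded[where B = 1]) (auto simp: indicator_def pmf_le_1)
  also have "\<dots> = pmf (S (s + t) x) x"
    using assms by (simp add: markov_semigroup_def pmf_bind)
  finally show ?thesis .
qed

text \<open>The rate at time zero bounds the probability of having left \<open>x\<close> at every time, because
  \<open>1 - P\<^sub>t(x,x)\<close> is subadditive in \<open>t\<close>: splitting \<open>[0,t]\<close> into \<open>n\<close> pieces gives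
  \<open>1 - P\<^sub>t(x,x) \<le> n (1 - P\<^bsub>t/n\<^esub>(x,x))\<close>, which tends to \<open>- t d\<close>. This is the uniform
  domination needed to interchange derivatives at zero with expectations.\<close>

lemma leaving_prob_le:
  assumes S: "markov_semigroup E S" and x: "x \<in> E"
    and d: "((\<lambda>t. pmf (S t x) x) has_real_derivative d) (at 0 within {0..})"
    and K: "- d \<le> K" and t: "0 \<le> t"
  shows "1 - pmf (S t x) x \<le> K * t"
proof (cases "t = 0")
  case True
  then show ?thesis using S x by (simp add: markov_semigroup_def)
next
  case False
  with t have t: "t > 0" by simp
  define g where "g u = pmf (S u x) x" for u
  have g: "g 0 = 1" "0 \<le> g u" "g u \<le> 1" for u
    using S x by (auto simp: g_def markov_semigroup_def pmf_le_1)
  have sub: "1 - g (real n * u) \<le> real n * (1 - g u)" if "u \<ge> 0" for n u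
  proof (induction n)
    case (Suc n)
    have "1 - g (real n * u + u) \<le> 1 - g (real n * u) * g u"
      using holding_supermultiplicative[OF S x, of "real n * u" u] that by (simp add: g_def)
    also have "\<dots> \<le> (1 - g (real n * u)) + (1 - g u)"
      using mult_nonneg_nonneg[of "1 - g (real n * u)" "1 - g u"] g(3) by (simp add: algebra_simps)
    also have "\<dots> \<le> real n * (1 - g u) + (1 - g u)" using Suc by simp
    finally show ?case by (simp add: algebra_simps)
  qed (simp add: g)
  define \<tau> where "\<tau> n = t / real (Suc n)" for n
  have \<tau>: "\<tau> n > 0" for n using t by (simp add: \<tau>_def)
  have "\<tau> \<longlonglongrightarrow> 0"
    unfolding \<tau>_def by (intro LIMSEQ_Suc[OF lim_const_over_n])
  then have lim: "(\<lambda>n. (g (\<tau> n) - g 0) / \<tau> n) \<longlonglongrightarrow> d"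
    using right_derivative_sequentially[OF d, of \<tau>] \<tau> by (simp add: g_def)
  have "1 - g t \<le> - d * t"
  proof (rule LIMSEQ_le_const)
    show "(\<lambda>n. - ((g (\<tau> n) - g 0) / \<tau> n) * t) \<longlonglongrightarrow> - d * t"
      by (intro tendsto_intros lim)
    have "1 - g t \<le> - ((g (\<tau> n) - g 0) / \<tau> n) * t" for n
    proof -
      have "real (Suc n) * \<tau> n = t" by (simp add: \<tau>_def)
      moreover from this have "real (Suc n) = t / \<tau> n" using \<tau>[of n] by (simp add: field_simps)
      ultimately have "1 - g t \<le> t / \<tau> n * (1 - g (\<tau> n))"
        using sub[of "\<tau> n" "Suc n"] \<tau>[of n] by (metis less_imp_le)
      moreover have "t / \<tau> n * (1 - g (\<tau> n)) = - ((g (\<tau> n) - g 0) / \<tau> n) * t"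
        using g(1) \<tau>[of n] by (simp add: field_simps)
      ultimately show ?thesis by simp
    qed
    then show "\<exists>N. \<forall>n\<ge>N. 1 - g t \<le> - ((g (\<tau> n) - g 0) / \<tau> n) * t" by blast
  qed
  also have "\<dots> \<le> K * t" using K t by (intro mult_right_mono) auto
  finally show ?thesis by (simp add: g_def)
qed

section \<open>Rates and the uniformised chain\<close>

lemma ennreal_finite_sum_le_infsum:
  fixes f :: "'a \<Rightarrow> ennreal"
  assumes "finite B" "B \<subseteq> A"
  shows "sum f B \<le> (\<Sum>\<^sub>\<infinity>x\<in>A. f x)"
  using infsum_mono_neutral[of f B f A] nonneg_summable_on_complete[of _ f] assms by auto

lemma exit_rates_bounded:
  assumes q: "rate_matrix (insert \<Delta> L) q" and fin: "max_exit_rate L \<Delta> q < \<infinity>" and x: "x \<in> L"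
  shows "- q x x \<le> enn2real (max_exit_rate L \<Delta> q)"
proof -
  let ?A = "insert \<Delta> L - {x}"
  have q': "\<forall>y\<in>?A. 0 \<le> q x y" "q x summable_on ?A" "q x x = - (\<Sum>\<^sub>\<infinity>y\<in>?A. q x y)"
    using q x unfolding rate_matrix_def by blast+
  have "(\<Sum>\<^sub>\<infinity>y\<in>?A. q x y) \<le> enn2real (max_exit_rate L \<Delta> q)"
  proof (rule infsum_le_finite_sums[OF q'(2)])
    fix B assume B: "finite B" "B \<subseteq> ?A"
    have "ennreal (sum (q x) B) = (\<Sum>y\<in>B. ennreal (q x y))"
      by (rule sum_ennreal[symmetric]) (use B q' in auto)
    also have "\<dots> \<le> (\<Sum>\<^sub>\<infinity>y\<in>?A. ennreal (q x y))"
      by (rule ennreal_finite_sum_le_infsum) (use B in auto)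
    also have "\<dots> \<le> max_exit_rate L \<Delta> q"
      unfolding max_exit_rate_def by (rule SUP_upper[OF x])
    finally have "enn2real (ennreal (sum (q x) B)) \<le> enn2real (max_exit_rate L \<Delta> q)"
      using fin by (intro enn2real_mono) auto
    then show "sum (q x) B \<le> enn2real (max_exit_rate L \<Delta> q)"
      using B q' by (simp add: sum_nonneg subset_iff)
  qed
  then show ?thesis using q' by simp
qed

text \<open>A finite part of the sum that defines the ergodicity coefficient already exceeds \<open>C\<close>.\<close>

lemma finite_minorant:
  assumes gap: "ennreal C < ergodicity_coeff L q" and C: "0 \<le> C"
    and nonneg: "\<And>x z. x \<in> L \<Longrightarrow> z \<in> L \<Longrightarrow> x \<noteq> z \<Longrightarrow> 0 \<le> q x z"
  obtains F a where "finite F" "F \<subseteq> L" "\<And>z. 0 \<le> a z"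
    "\<And>x z. x \<in> L \<Longrightarrow> z \<in> F \<Longrightarrow> x \<noteq> z \<Longrightarrow> a z \<le> q x z" "C < sum a F"
proof -
  define I where "I z = (INF x\<in>L - {z}. ennreal (q x z))" for z
  have "ergodicity_coeff L q = (SUP F\<in>{F. finite F \<and> F \<subseteq> L}. sum I F)"
    unfolding ergodicity_coeff_def I_def[symmetric]
    by (rule nonneg_infsum_complete) simp
  then obtain F where F: "finite F" "F \<subseteq> L" "ennreal C < sum I F"
    using gap by (auto simp: less_SUP_iff)
  \<comment> \<open>The truncation makes the minorant finite when \<open>L\<close> is a single point.\<close>
  define a where "a z = enn2real (min (I z) (ennreal (C + 1)))" for z
  have a: "ennreal (a z) = min (I z) (ennreal (C + 1))" for z
    unfolding a_def by (intro ennreal_enn2real) (simp add: min_less_iff_disj)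
  have "C < sum a F"
  proof (cases "\<exists>z\<in>F. ennreal (C + 1) \<le> I z")
    case True
    then obtain z where z: "z \<in> F" "a z = C + 1" using C by (auto simp: a_def min_def)
    have "a z \<le> sum a F" using F z by (intro member_le_sum) (auto simp: a_def)
    then show ?thesis using z by simp
  next
    case False
    then have "ennreal (a z) = I z" if "z \<in> F" for z using that by (auto simp: a min_def)
    then have "sum I F = (\<Sum>z\<in>F. ennreal (a z))" by simp
    also have "\<dots> = ennreal (sum a F)" by (rule sum_ennreal) (simp add: a_def)
    finally show ?thesis using F C by (simp add: ennreal_less_iff)
  qed
  moreover have "a z \<le> q x z" if "x \<in> L" "z \<in> F" "x \<noteq> z" for x z
  proof -
    have "ennreal (a z) \<le> I z" by (simp add: a)
    also have "\<dots> \<le> ennreal (q x z)" unfolding I_def using that by (intro INF_lower) auto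
    finally show ?thesis using nonneg[of x z] that F by (auto simp: ennreal_le_iff)
  qed
  moreover have "0 \<le> a z" for z by (simp add: a_def)
  ultimately show thesis using that F by blast
qed

text \<open>The data extracted from the hypotheses: a bound \<open>K\<close> on the exit rates, a bound \<open>C\<close> on the
  killing rates and a finitely supported minorant \<open>a\<close> of total mass above \<open>C\<close>.\<close>

locale bounded_killed_rates =
  fixes L :: "'s set" and \<Delta> :: 's and q :: "'s \<Rightarrow> 's \<Rightarrow> real"
    and K C :: real and F :: "'s set" and a :: "'s \<Rightarrow> real"
  assumes notin: "\<Delta> \<notin> L" and L_nonempty: "L \<noteq> {}"
    and rates: "rate_matrix (insert \<Delta> L) q" and absorbing: "\<And>x. x \<in> L \<Longrightarrow> q \<Delta> x = 0"
    and exit_le: "\<And>x. x \<in> L \<Longrightarrow> - q x x \<le> K"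
    and kill_le: "\<And>x. x \<in> L \<Longrightarrow> q x \<Delta> \<le> C"
    and F_fin: "finite F" "F \<subseteq> L" and a_nonneg: "\<And>z. 0 \<le> a z"
    and a_le: "\<And>x z. x \<in> L \<Longrightarrow> z \<in> F \<Longrightarrow> x \<noteq> z \<Longrightarrow> a z \<le> q x z"
    and C_less: "C < sum a F"
begin

text \<open>The inequality \<open>a(z) \<le> q(x,z)\<close> is available off the diagonal only. With this step size the holding
  probability \<open>1 + \<delta> q(x,x)\<close> is at least \<open>\<delta>\<close> times the total mass of \<open>a\<close>, so that
  \<open>\<delta> a\<close> minorises the step on the diagonal as well.\<close>

definition \<delta> :: real where "\<delta> = 1 / (K + sum a F)"

definition J :: "'s \<Rightarrow> 's pmf" where
  "J x = (SOME p. pmf p = (\<lambda>y. indicator {x} y + \<delta> * (if y \<in> insert \<Delta> L then q x y else 0)))"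

lemma rate_nonneg: "x \<in> insert \<Delta> L \<Longrightarrow> y \<in> insert \<Delta> L \<Longrightarrow> x \<noteq> y \<Longrightarrow> 0 \<le> q x y"
  using rates by (auto simp: rate_matrix_def)

lemma rate_has_sum:
  assumes "x \<in> insert \<Delta> L" shows "(q x has_sum (- q x x)) (insert \<Delta> L - {x})"
  using assms rates by (auto simp: rate_matrix_def intro!: has_sum_infsum)

lemma K_nonneg: "0 \<le> K"
proof -
  obtain x where x: "x \<in> L" using L_nonempty by blast
  have "0 \<le> (\<Sum>\<^sub>\<infinity>y\<in>insert \<Delta> L - {x}. q x y)"
    using rate_nonneg x by (intro infsum_nonneg) auto
  then show ?thesis using exit_le[OF x] rates x by (auto simp: rate_matrix_def)
qed

lemma C_nonneg: "0 \<le> C"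
  using L_nonempty kill_le rate_nonneg notin by (metis all_not_in_conv insertCI order_trans)

lemma \<delta>: "0 < \<delta>" "\<delta> * K + \<delta> * sum a F = 1"
proof -
  have "0 < K + sum a F" using K_nonneg C_nonneg C_less by simp
  then show "0 < \<delta>" "\<delta> * K + \<delta> * sum a F = 1"
    by (simp_all add: \<delta>_def flip: add_divide_distrib)
qed

lemma pmf_J:
  assumes x: "x \<in> L"
  shows "pmf (J x) y = indicator {x} y + \<delta> * (if y \<in> insert \<Delta> L then q x y else 0)"
proof -
  let ?f = "\<lambda>y. indicator {x} y + \<delta> * (if y \<in> insert \<Delta> L then q x y else 0)"
  have "(q x has_sum (- q x x + q x x)) ((insert \<Delta> L - {x}) \<union> {x})"
    using x by (intro has_sum_Un_disjoint rate_has_sum has_sum_finiteI) auto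
  moreover have "(insert \<Delta> L - {x}) \<union> {x} = insert \<Delta> L" using x by auto
  ultimately have "(q x has_sum 0) (insert \<Delta> L)" by simp
  then have "((\<lambda>y. if y \<in> insert \<Delta> L then q x y else 0) has_sum 0) UNIV"
    by (subst has_sum_cong_neutral[where T = "insert \<Delta> L" and g = "q x"]) auto
  then have "((\<lambda>y. \<delta> * (if y \<in> insert \<Delta> L then q x y else 0)) has_sum (\<delta> * 0)) UNIV"
    by (rule has_sum_cmult_right)
  moreover have "((indicator {x} :: 's \<Rightarrow> real) has_sum 1) UNIV"
    by (subst has_sum_cong_neutral[where T = "{x}" and g = "\<lambda>_. 1"]) (auto simp: indicator_def intro: has_sum_finiteI)
  ultimately have "(?f has_sum (1 + \<delta> * 0)) UNIV" by (intro has_sum_add)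
  moreover have "0 \<le> ?f y" for y
  proof (cases "y = x")
    case True
    have "\<delta> * (- q x x) \<le> \<delta> * K" using exit_le[OF x] \<delta> by (intro mult_left_mono) auto
    also have "\<dots> \<le> 1" using \<delta> a_nonneg by (simp add: sum_nonneg flip: \<delta>(2))
    finally show ?thesis using True x by simp
  qed (use rate_nonneg[of x y] x \<delta> in auto)
  ultimately have "\<exists>p. pmf p = ?f" by (intro pmf_of_has_sum_1) auto
  then have "pmf (J x) = ?f" unfolding J_def by (rule someI_ex)
  then show ?thesis by simp
qed

lemma set_J: "x \<in> L \<Longrightarrow> set_pmf (J x) \<subseteq> insert \<Delta> L"
  by (auto simp: set_pmf_eq pmf_J indicator_def split: if_splits)

lemma J_absorption: "x \<in> L \<Longrightarrow> pmf (J x) \<Delta> = \<delta> * q x \<Delta>"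
  using notin by (auto simp: pmf_J indicator_def)

lemma J_minorised: assumes x: "x \<in> L" and z: "z \<in> F" shows "\<delta> * a z \<le> pmf (J x) z"
proof (cases "z = x")
  case True
  have "\<delta> * (- q x x) + \<delta> * a z \<le> \<delta> * K + \<delta> * sum a F"
    using exit_le[OF x] \<delta> a_nonneg F_fin z
    by (intro add_mono mult_left_mono member_le_sum) auto
  then show ?thesis using \<delta> True x by (simp add: pmf_J)
next
  case False
  then show ?thesis using a_le[OF x z] \<delta> F_fin x z by (auto simp: pmf_J)
qed

sublocale absorbed_chain L \<Delta> J F "\<lambda>z. \<delta> * a z" "\<delta> * C"
proof
  show "\<delta> * C < (\<Sum>z\<in>F. \<delta> * a z)"
    using C_less \<delta> by (simp flip: sum_distrib_left)
qed (use notin L_nonempty set_J F_fin a_nonneg \<delta> J_minorised J_absorption kill_le in auto)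

lemma spectral_gap: "(\<Sum>z\<in>F. \<delta> * a z) - \<delta> * C = \<delta> * (sum a F - C)"
  by (simp add: right_diff_distrib flip: sum_distrib_left)

end

section \<open>Quasi-stationary laws are the reinjection-invariant laws\<close>

locale absorbed_process = bounded_killed_rates +
  fixes P :: "real \<Rightarrow> 'a \<Rightarrow> 'a pmf"
  assumes semigroup: "markov_semigroup (insert \<Delta> L) P"
    and transition_rates: "has_transition_rates (insert \<Delta> L) P q"
begin

text \<open>The unconditioned law at time \<open>t\<close>, mass at \<open>\<Delta>\<close> included.\<close>

definition law :: "'a pmf \<Rightarrow> real \<Rightarrow> 'a pmf" where "law \<nu> t = bind_pmf \<nu> (P t)"

lemma transition_derivative:
  "x \<in> insert \<Delta> L \<Longrightarrow> y \<in> insert \<Delta> L \<Longrightarrow>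
    ((\<lambda>t. pmf (P t x) y) has_real_derivative q x y) (at 0 within {0..})"
  using transition_rates by (auto simp: has_transition_rates_def)

lemma leaving_le: "x \<in> L \<Longrightarrow> 0 \<le> t \<Longrightarrow> 1 - pmf (P t x) x \<le> K * t"
  using leaving_prob_le[OF semigroup _ transition_derivative] exit_le by auto

lemma absorbed_forever:
  assumes "0 \<le> t" shows "P t \<Delta> = return_pmf \<Delta>"
proof -
  have "(\<Sum>\<^sub>\<infinity>y\<in>insert \<Delta> L - {\<Delta>}. q \<Delta> y) = 0"
    by (rule infsum_0) (use absorbing in auto)
  then have "q \<Delta> \<Delta> = 0" using rates by (auto simp: rate_matrix_def)
  then have "1 - pmf (P t \<Delta>) \<Delta> \<le> 0"
    using leaving_prob_le[OF semigroup _ transition_derivative, of \<Delta> 0 t] assms by auto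
  then have "set_pmf (P t \<Delta>) \<subseteq> {\<Delta>}"
    by (intro set_pmf_subset_if_measure_1) (simp add: measure_pmf_single order_antisym pmf_le_1)
  then show ?thesis by (simp add: set_pmf_subset_singleton)
qed

lemma
  assumes "x \<in> insert \<Delta> L"
  shows set_P: "0 \<le> t \<Longrightarrow> set_pmf (P t x) \<subseteq> insert \<Delta> L"
    and P_0: "P 0 x = return_pmf x"
    and P_add: "0 \<le> s \<Longrightarrow> 0 \<le> t \<Longrightarrow> P (s + t) x = bind_pmf (P s x) (P t)"
  using semigroup assms unfolding markov_semigroup_def by blast+

lemma set_law: "set_pmf \<nu> \<subseteq> L \<Longrightarrow> 0 \<le> t \<Longrightarrow> set_pmf (law \<nu> t) \<subseteq> insert \<Delta> L"
  using set_P by (fastforce simp: law_def)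

lemma law_0: "set_pmf \<nu> \<subseteq> L \<Longrightarrow> law \<nu> 0 = \<nu>"
  using bind_pmf_cong[of \<nu> \<nu> "P 0" return_pmf] P_0
  by (auto simp: law_def bind_return_pmf')

lemma law_add: "set_pmf \<nu> \<subseteq> L \<Longrightarrow> 0 \<le> s \<Longrightarrow> 0 \<le> t \<Longrightarrow> law \<nu> (s + t) = bind_pmf (law \<nu> s) (P t)"
  unfolding law_def bind_assoc_pmf
  by (intro bind_pmf_cong refl P_add) auto

lemma pmf_law: "pmf (law \<nu> t) z = expect \<nu> (\<lambda>x. pmf (P t x) z)"
  by (simp add: law_def pmf_bind)

lemma conditioned_law_eq:
  assumes "set_pmf \<nu> \<subseteq> L"
  shows "conditioned_law L \<Delta> P \<nu> t x = pmf (law \<nu> t) x / (1 - pmf (law \<nu> t) \<Delta>)"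
  unfolding conditioned_law_def pmf_law
  by (subst (1 2) infsum_pmf_eq_expect[where B = 1]) (use assms in \<open>auto simp: pmf_le_1\<close>)

text \<open>The derivative of the law at time zero is \<open>\<nu> Q = \<nu> (J - I) / \<delta>\<close> at each site.
  The difference quotients are dominated by the bound \<open>K\<close> on the exit rates.\<close>

lemma law_derivative:
  assumes \<nu>: "set_pmf \<nu> \<subseteq> L" and z: "z \<in> insert \<Delta> L" and \<tau>: "\<And>n. 0 < \<tau> n" "\<tau> \<longlonglongrightarrow> 0"
  shows "(\<lambda>n. (pmf (law \<nu> (\<tau> n)) z - pmf \<nu> z) / \<tau> n) \<longlonglongrightarrow> (expect \<nu> (\<lambda>x. pmf (J x) z) - pmf \<nu> z) / \<delta>"
proof -
  have int: "integrable (measure_pmf \<nu>) (\<lambda>x. pmf (p x) z)" for p :: "'a \<Rightarrow> 'a pmf"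
    by (rule integrable_pmf_bounded[where B = 1]) (simp add: pmf_le_1)
  have ind: "integrable (measure_pmf \<nu>) (indicator {z} :: 'a \<Rightarrow> real)"
    by (rule integrable_pmf_bounded[where B = 1]) (simp add: indicator_def)
  have "(\<lambda>n. expect \<nu> (\<lambda>x. (pmf (P (\<tau> n) x) z - indicator {z} x) / \<tau> n))
      \<longlonglongrightarrow> expect \<nu> (\<lambda>x. (pmf (J x) z - indicator {z} x) / \<delta>)"
  proof (rule integral_dominated_convergence[where w = "\<lambda>_. K"])
    show "AE x in measure_pmf \<nu>. (\<lambda>n. (pmf (P (\<tau> n) x) z - indicator {z} x) / \<tau> n)
        \<longlonglongrightarrow> (pmf (J x) z - indicator {z} x) / \<delta>"
      unfolding AE_measure_pmf_iff
    proof
      fix x assume "x \<in> set_pmf \<nu>"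
      with \<nu> have x: "x \<in> L" by auto
      have "pmf (P 0 x) z = indicator {z} x"
        using P_0 x by (auto simp: indicator_def)
      moreover have "(pmf (J x) z - indicator {z} x) / \<delta> = q x z"
        using \<delta> z x by (auto simp: pmf_J indicator_def)
      ultimately show "(\<lambda>n. (pmf (P (\<tau> n) x) z - indicator {z} x) / \<tau> n)
          \<longlonglongrightarrow> (pmf (J x) z - indicator {z} x) / \<delta>"
        using right_derivative_sequentially[OF transition_derivative \<tau>, of x z] x z by simp
    qed
    show "AE x in measure_pmf \<nu>. norm ((pmf (P (\<tau> n) x) z - indicator {z} x) / \<tau> n) \<le> K" for n
      unfolding AE_measure_pmf_iff
    proof
      fix x assume "x \<in> set_pmf \<nu>"
      with \<nu> have x: "x \<in> L" by auto
      have "(indicator {z} x :: real) = indicator {x} z" by (simp add: indicator_def)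
      then have "\<bar>pmf (P (\<tau> n) x) z - indicator {z} x\<bar> \<le> 1 - pmf (P (\<tau> n) x) x"
        using pmf_change_le[of "P (\<tau> n) x" z x] by simp
      also have "\<dots> \<le> K * \<tau> n" using leaving_le x \<tau>(1) less_imp_le by metis
      finally show "norm ((pmf (P (\<tau> n) x) z - indicator {z} x) / \<tau> n) \<le> K"
        using \<tau>(1)[of n] by (simp add: abs_divide divide_le_eq)
    qed
  qed auto
  then show ?thesis
    using int ind by (simp add: pmf_law measure_pmf_single)
qed

text \<open>Differentiating \<open>\<nu> P\<^sub>t = (1 - \<nu> P\<^sub>t(\<Delta>)) \<nu>\<close> at time zero. The survival probability cannot
  vanish: the conditioned law would then be \<open>0\<close> everywhere because of division by zero.\<close>

lemma quasi_stationary_imp_reinject_fixed: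
  assumes "quasi_stationary L \<Delta> P \<nu>"
  shows "reinject \<nu> = \<nu>"
proof -
  have \<nu>: "set_pmf \<nu> \<subseteq> L" using assms by (simp add: quasi_stationary_def)
  have "pmf \<nu> \<Delta> = 0" using \<nu> notin by (auto simp: pmf_eq_0_set_pmf)
  have decay: "pmf (law \<nu> t) z - pmf \<nu> z = - pmf (law \<nu> t) \<Delta> * pmf \<nu> z" if "z \<in> L" "t \<ge> 0" for z t
  proof -
    have *: "pmf (law \<nu> t) z / (1 - pmf (law \<nu> t) \<Delta>) = pmf \<nu> z" if "z \<in> L" for z
      using assms conditioned_law_eq[OF \<nu>] that \<open>t \<ge> 0\<close> by (simp add: quasi_stationary_def)
    obtain x where x: "x \<in> set_pmf \<nu>" using set_pmf_not_empty by fast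
    then have "pmf \<nu> x \<noteq> 0" "x \<in> L" using \<nu> by (auto simp: set_pmf_eq)
    then have "1 - pmf (law \<nu> t) \<Delta> \<noteq> 0" using *[of x] by auto
    then show ?thesis using *[OF \<open>z \<in> L\<close>] by (simp add: field_simps)
  qed
  define \<tau> where "\<tau> n = 1 / real (Suc n)" for n
  have \<tau>: "0 < \<tau> n" "\<tau> \<longlonglongrightarrow> 0" for n
    using LIMSEQ_Suc[OF lim_const_over_n[of 1]] unfolding \<tau>_def by simp_all
  show ?thesis unfolding reinject_fixed_iff[OF \<nu>]
  proof
    fix z assume z: "z \<in> L"
    have "(\<lambda>n. (pmf (law \<nu> (\<tau> n)) z - pmf \<nu> z) / \<tau> n)
        \<longlonglongrightarrow> (expect \<nu> (\<lambda>x. pmf (J x) z) - pmf \<nu> z) / \<delta>"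
      using z by (intro law_derivative \<nu> \<tau>) auto
    moreover have "(\<lambda>n. (pmf (law \<nu> (\<tau> n)) \<Delta> - pmf \<nu> \<Delta>) / \<tau> n)
        \<longlonglongrightarrow> (expect \<nu> (\<lambda>x. pmf (J x) \<Delta>) - pmf \<nu> \<Delta>) / \<delta>"
      by (intro law_derivative \<nu> \<tau>) auto
    then have "(\<lambda>n. - ((pmf (law \<nu> (\<tau> n)) \<Delta> - pmf \<nu> \<Delta>) / \<tau> n) * pmf \<nu> z)
        \<longlonglongrightarrow> - ((expect \<nu> (\<lambda>x. pmf (J x) \<Delta>) - pmf \<nu> \<Delta>) / \<delta>) * pmf \<nu> z"
      by (intro tendsto_mult tendsto_minus tendsto_const)
    then have "(\<lambda>n. (pmf (law \<nu> (\<tau> n)) z - pmf \<nu> z) / \<tau> n)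
        \<longlonglongrightarrow> - ((expect \<nu> (\<lambda>x. pmf (J x) \<Delta>) - pmf \<nu> \<Delta>) / \<delta>) * pmf \<nu> z"
      using decay[OF z less_imp_le[OF \<tau>(1)]] \<open>pmf \<nu> \<Delta> = 0\<close> by simp
    ultimately have "(expect \<nu> (\<lambda>x. pmf (J x) z) - pmf \<nu> z) / \<delta>
        = - ((expect \<nu> (\<lambda>x. pmf (J x) \<Delta>) - pmf \<nu> \<Delta>) / \<delta>) * pmf \<nu> z"
      by (rule LIMSEQ_unique)
    also have "\<dots> = (- expect \<nu> (\<lambda>x. pmf (J x) \<Delta>) * pmf \<nu> z) / \<delta>"
      using \<open>pmf \<nu> \<Delta> = 0\<close> by simp
    finally have "expect \<nu> (\<lambda>x. pmf (J x) z) - pmf \<nu> z = - expect \<nu> (\<lambda>x. pmf (J x) \<Delta>) * pmf \<nu> z"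
      unfolding divide_cancel_right using \<delta>(1) by simp
    then show "expect \<nu> (\<lambda>x. pmf (J x) z) = (1 - expect \<nu> (\<lambda>x. pmf (J x) \<Delta>)) * pmf \<nu> z"
      by (simp add: algebra_simps)
  qed
qed

text \<open>The sitewise derivative at zero holds uniformly over test functions. Adding \<open>K \<nu>\<close> makes the
  difference quotients nonnegative, since \<open>\<nu> P\<^sub>t \<ge> (1 - K t) \<nu>\<close>; their total mass is \<open>K\<close>, as is
  that of the sitewise limit, so Scheffe's lemma upgrades sitewise convergence to convergence in
  \<open>\<ell>\<^sup>1\<close>.\<close>

lemma reinject_fixed_short_time:
  assumes \<nu>: "set_pmf \<nu> \<subseteq> L" and fixed: "reinject \<nu> = \<nu>" and \<tau>: "\<And>n. 0 < \<tau> n" "\<tau> \<longlonglongrightarrow> 0"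
  defines "\<theta> \<equiv> expect \<nu> (\<lambda>x. pmf (J x) \<Delta>) / \<delta>"
  obtains \<epsilon> where "\<epsilon> \<longlonglongrightarrow> 0"
    "\<And>n g. (\<And>y. \<bar>g y\<bar> \<le> 1) \<Longrightarrow> g \<Delta> = 0 \<Longrightarrow>
      \<bar>expect (law \<nu> (\<tau> n)) g - (1 - \<theta> * \<tau> n) * expect \<nu> g\<bar> \<le> \<tau> n * \<epsilon> n"
proof -
  let ?M = "count_space (UNIV :: 'a set)"
  have \<nu>\<Delta>: "pmf \<nu> \<Delta> = 0" using \<nu> notin by (auto simp: pmf_eq_0_set_pmf)
  define f where "f n z = (pmf (law \<nu> (\<tau> n)) z - pmf \<nu> z) / \<tau> n + K * pmf \<nu> z" for n z
  define l where "l z = (K - \<theta>) * pmf \<nu> z + \<theta> * pmf (return_pmf \<Delta>) z" for z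
  have f0: "0 \<le> f n z" for n z
  proof -
    have "(1 - K * \<tau> n) * pmf \<nu> z = expect \<nu> (\<lambda>x. (1 - K * \<tau> n) * indicator {z} x)"
      by (simp add: measure_pmf_single)
    also have "\<dots> \<le> expect \<nu> (\<lambda>x. pmf (P (\<tau> n) x) z)"
    proof (rule integral_mono_AE)
      show "integrable (measure_pmf \<nu>) (\<lambda>x. (1 - K * \<tau> n) * indicator {z} x)"
        by (rule integrable_pmf_bounded[where B = "\<bar>1 - K * \<tau> n\<bar>"]) (simp add: indicator_def)
      show "integrable (measure_pmf \<nu>) (\<lambda>x. pmf (P (\<tau> n) x) z)"
        by (rule integrable_pmf_bounded[where B = 1]) (simp add: pmf_le_1)
      show "AE x in measure_pmf \<nu>. (1 - K * \<tau> n) * indicator {z} x \<le> pmf (P (\<tau> n) x) z"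
        unfolding AE_measure_pmf_iff
      proof
        fix x assume "x \<in> set_pmf \<nu>"
        then have "1 - pmf (P (\<tau> n) x) x \<le> K * \<tau> n"
          using \<nu> \<tau>(1)[of n] by (intro leaving_le) auto
        then show "(1 - K * \<tau> n) * indicator {z} x \<le> pmf (P (\<tau> n) x) z"
          by (auto simp: indicator_def)
      qed
    qed
    finally have "(1 - K * \<tau> n) * pmf \<nu> z \<le> pmf (law \<nu> (\<tau> n)) z" by (simp add: pmf_law)
    then show ?thesis using \<tau>(1)[of n] by (simp add: f_def field_simps)
  qed
  have lim: "(\<lambda>n. f n z) \<longlonglongrightarrow> l z" for z
  proof (cases "z \<in> insert \<Delta> L")
    case True
    have "(expect \<nu> (\<lambda>x. pmf (J x) z) - pmf \<nu> z) / \<delta> + K * pmf \<nu> z = l z"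
    proof (cases "z = \<Delta>")
      case False
      with True have "expect \<nu> (\<lambda>x. pmf (J x) z) = (1 - expect \<nu> (\<lambda>x. pmf (J x) \<Delta>)) * pmf \<nu> z"
        using fixed unfolding reinject_fixed_iff[OF \<nu>] by blast
      then show ?thesis using False \<delta> by (simp add: l_def \<theta>_def field_simps)
    qed (simp add: l_def \<theta>_def \<nu>\<Delta>)
    moreover have "(\<lambda>n. f n z) \<longlonglongrightarrow> (expect \<nu> (\<lambda>x. pmf (J x) z) - pmf \<nu> z) / \<delta> + K * pmf \<nu> z"
      unfolding f_def by (intro tendsto_intros law_derivative \<nu> True \<tau>)
    ultimately show ?thesis by simp
  next
    case False
    have "z \<notin> set_pmf (law \<nu> (\<tau> n))" for n
      using set_law[OF \<nu>, of "\<tau> n"] \<tau>(1)[of n] False by auto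
    then have "pmf (law \<nu> (\<tau> n)) z = 0" "pmf \<nu> z = 0" "pmf (return_pmf \<Delta>) z = 0" for n
      using \<nu> False by (auto simp: pmf_eq_0_set_pmf)
    then show ?thesis by (simp add: f_def l_def)
  qed
  have l0: "0 \<le> l z" for z
    by (rule LIMSEQ_le_const[OF lim]) (use f0 in auto)
  have int: "integrable ?M (f n)" "integrable ?M l" for n
    unfolding f_def l_def
    by (intro Bochner_Integration.integrable_add Bochner_Integration.integrable_diff
        integrable_mult_right integrable_divide integrable_pmf)+
  have tot: "(\<integral>z. f n z \<partial>?M) = K" "(\<integral>z. l z \<partial>?M) = K" for n
    unfolding f_def l_def by (simp_all add: integrable_pmf integral_pmf del: pmf_return)
  have nn: "(\<integral>\<^sup>+ z. norm (f n z) \<partial>?M) = ennreal K" "(\<integral>\<^sup>+ z. norm (l z) \<partial>?M) = ennreal K" for n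
    using f0 l0 by (simp_all add: nn_integral_eq_integral int tot)
  define \<epsilon> where "\<epsilon> n = (\<integral>z. \<bar>f n z - l z\<bar> \<partial>?M)" for n
  have "(\<lambda>n. \<integral>\<^sup>+ z. norm (f n z - l z) \<partial>?M) \<longlonglongrightarrow> 0"
    by (rule Scheffe_lemma2) (use int lim nn in auto)
  then have "(\<lambda>n. ennreal (\<epsilon> n)) \<longlonglongrightarrow> 0"
    by (simp add: \<epsilon>_def nn_integral_eq_integral int)
  then have \<epsilon>: "\<epsilon> \<longlonglongrightarrow> 0"
    by (subst (asm) ennreal_tendsto_0_iff) (simp_all add: \<epsilon>_def)
  have "\<bar>expect (law \<nu> (\<tau> n)) g - (1 - \<theta> * \<tau> n) * expect \<nu> g\<bar> \<le> \<tau> n * \<epsilon> n"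
    if g: "\<And>y. \<bar>g y\<bar> \<le> 1" and g\<Delta>: "g \<Delta> = 0" for n g
  proof -
    have i: "integrable ?M (\<lambda>x. pmf p x * g x)"
      and e: "expect p g = (\<integral>x. pmf p x * g x \<partial>?M)" for p
      using pmf_count_space_integral[of g 1 p] g by blast+
    have eq: "(f n z - l z) * g z = (pmf (law \<nu> (\<tau> n)) z * g z - pmf \<nu> z * g z) / \<tau> n
        + \<theta> * (pmf \<nu> z * g z) - \<theta> * (pmf (return_pmf \<Delta>) z * g z)" for z
      by (simp add: f_def l_def algebra_simps diff_divide_distrib add_divide_distrib)
    have "(\<integral>z. (f n z - l z) * g z \<partial>?M)
        = (expect (law \<nu> (\<tau> n)) g - expect \<nu> g) / \<tau> n + \<theta> * expect \<nu> g"
      unfolding eq using e[of "return_pmf \<Delta>"] e[of \<nu>] e[of "law \<nu> (\<tau> n)"] g\<Delta>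
      by (simp add: i del: pmf_return)
    then have "expect (law \<nu> (\<tau> n)) g - (1 - \<theta> * \<tau> n) * expect \<nu> g
        = \<tau> n * (\<integral>z. (f n z - l z) * g z \<partial>?M)"
      using \<tau>(1)[of n] by (simp add: field_simps)
    also have "\<bar>\<dots>\<bar> = \<tau> n * \<bar>\<integral>z. (f n z - l z) * g z \<partial>?M\<bar>"
      using \<tau>(1)[of n] by (simp add: abs_mult)
    also have "\<bar>\<integral>z. (f n z - l z) * g z \<partial>?M\<bar> \<le> (\<integral>z. \<bar>(f n z - l z) * g z\<bar> \<partial>?M)"
      by (rule integral_abs_bound)
    also have "\<dots> \<le> \<epsilon> n" unfolding \<epsilon>_def
    proof (rule integral_mono)
      show "integrable ?M (\<lambda>z. \<bar>(f n z - l z) * g z\<bar>)"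
        unfolding eq by (intro integrable_abs) (simp add: i del: pmf_return)
      show "\<bar>(f n z - l z) * g z\<bar> \<le> \<bar>f n z - l z\<bar>" for z
        using g[of z] by (simp add: abs_mult mult_left_le)
    qed (simp add: int)
    finally show ?thesis using \<tau>(1)[of n] by simp
  qed
  with \<epsilon> show thesis by (rule that)
qed

text \<open>Applying the short-time estimate to the test functions \<open>P\<^sub>s(\<cdot>, z)\<close> shows that
  \<open>u(t) = \<nu> P\<^sub>t(z)\<close> satisfies \<open>u(\<tau> + s) = (1 - \<theta> \<tau>) u(s) + o(\<tau>)\<close> uniformly in \<open>s\<close>. With \<open>n\<close> steps
  of length \<open>t/n\<close> the errors add up to \<open>o(1)\<close>, and \<open>(1 - \<theta> t/n)\<^sup>n\<close> tends to \<open>exp (- \<theta> t)\<close>.\<close>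

lemma reinject_fixed_decay:
  assumes \<nu>: "set_pmf \<nu> \<subseteq> L" and fixed: "reinject \<nu> = \<nu>" and z: "z \<in> L" and t: "0 \<le> t"
  shows "pmf (law \<nu> t) z = exp (- (expect \<nu> (\<lambda>x. pmf (J x) \<Delta>) / \<delta>) * t) * pmf \<nu> z"
proof (cases "t = 0")
  case True
  then show ?thesis using law_0[OF \<nu>] by simp
next
  case False
  with t have t: "0 < t" by simp
  define \<theta> where "\<theta> = expect \<nu> (\<lambda>x. pmf (J x) \<Delta>) / \<delta>"
  have \<theta>: "0 \<le> \<theta>" using expect_absorption(1)[OF \<nu>] \<delta> by (simp add: \<theta>_def)
  define \<tau> where "\<tau> n = t / real (Suc n)" for n
  have \<tau>: "0 < \<tau> n" "\<tau> \<longlonglongrightarrow> 0" for n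
    using t LIMSEQ_Suc[OF lim_const_over_n[of t]] unfolding \<tau>_def by simp_all
  obtain \<epsilon> where \<epsilon>: "\<epsilon> \<longlonglongrightarrow> 0"
    and short: "\<And>n g. (\<And>y. \<bar>g y\<bar> \<le> 1) \<Longrightarrow> g \<Delta> = 0 \<Longrightarrow>
      \<bar>expect (law \<nu> (\<tau> n)) g - (1 - \<theta> * \<tau> n) * expect \<nu> g\<bar> \<le> \<tau> n * \<epsilon> n"
    using reinject_fixed_short_time[OF \<nu> fixed \<tau>] unfolding \<theta>_def by blast
  define u where "u s = pmf (law \<nu> s) z" for s
  have step: "\<bar>u (\<tau> n + s) - (1 - \<theta> * \<tau> n) * u s\<bar> \<le> \<tau> n * \<epsilon> n" if s: "0 \<le> s" for n s
  proof -
    have "u (\<tau> n + s) = expect (law \<nu> (\<tau> n)) (\<lambda>y. pmf (P s y) z)"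
      unfolding u_def using law_add[OF \<nu> less_imp_le[OF \<tau>(1)] s] by (simp add: pmf_bind)
    moreover have "u s = expect \<nu> (\<lambda>y. pmf (P s y) z)" by (simp add: u_def pmf_law)
    moreover have "pmf (P s \<Delta>) z = 0" using absorbed_forever[OF s] z notin by (auto simp: indicator_def)
    ultimately show ?thesis using short[of "\<lambda>y. pmf (P s y) z" n] by (simp add: pmf_le_1)
  qed
  have iter: "\<bar>u (real k * \<tau> n) - (1 - \<theta> * \<tau> n) ^ k * u 0\<bar> \<le> real k * (\<tau> n * \<epsilon> n)"
    if n: "\<theta> * \<tau> n \<le> 1" for k n
  proof (induction k)
    case (Suc k)
    let ?c = "1 - \<theta> * \<tau> n"
    have c: "0 \<le> ?c" "?c \<le> 1" using n \<theta> \<tau>(1)[of n] by auto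
    have "\<bar>u (\<tau> n + real k * \<tau> n) - ?c ^ Suc k * u 0\<bar>
        \<le> \<bar>u (\<tau> n + real k * \<tau> n) - ?c * u (real k * \<tau> n)\<bar> + \<bar>?c * (u (real k * \<tau> n) - ?c ^ k * u 0)\<bar>"
      by (simp add: algebra_simps)
    also have "\<bar>?c * (u (real k * \<tau> n) - ?c ^ k * u 0)\<bar> \<le> \<bar>u (real k * \<tau> n) - ?c ^ k * u 0\<bar>"
      using c by (simp add: abs_mult mult_left_le_one_le)
    also note Suc
    also have "\<bar>u (\<tau> n + real k * \<tau> n) - ?c * u (real k * \<tau> n)\<bar> \<le> \<tau> n * \<epsilon> n"
      using step[of "real k * \<tau> n" n] \<tau>(1)[of n] by simp
    finally show ?case by (simp add: algebra_simps)
  qed simp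
  have "(\<lambda>n. (1 - \<theta> * \<tau> n) ^ Suc n * u 0) \<longlonglongrightarrow> u t"
  proof (rule LIMSEQ_I)
    fix e :: real assume "e > 0"
    have "(\<lambda>n. \<theta> * \<tau> n) \<longlonglongrightarrow> \<theta> * 0" "(\<lambda>n. t * \<epsilon> n) \<longlonglongrightarrow> t * 0"
      by (intro tendsto_intros \<tau> \<epsilon>)+
    then have "\<forall>\<^sub>F n in sequentially. \<theta> * \<tau> n < 1 \<and> t * \<epsilon> n < e"
      using \<open>e > 0\<close> by (intro eventually_conj order_tendstoD) auto
    then obtain N where N: "\<And>n. n \<ge> N \<Longrightarrow> \<theta> * \<tau> n < 1 \<and> t * \<epsilon> n < e"
      by (auto simp: eventually_sequentially)
    show "\<exists>N. \<forall>n\<ge>N. norm ((1 - \<theta> * \<tau> n) ^ Suc n * u 0 - u t) < e"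
    proof (intro exI[of _ N] allI impI)
      fix n assume "n \<ge> N"
      have "real (Suc n) * \<tau> n = t" by (simp add: \<tau>_def)
      then have "\<bar>u t - (1 - \<theta> * \<tau> n) ^ Suc n * u 0\<bar> \<le> t * \<epsilon> n"
        using iter[of n "Suc n"] N[OF \<open>n \<ge> N\<close>] by (metis less_imp_le mult.assoc)
      with N[OF \<open>n \<ge> N\<close>] show "norm ((1 - \<theta> * \<tau> n) ^ Suc n * u 0 - u t) < e"
        unfolding real_norm_def by argo
    qed
  qed
  moreover have "(\<lambda>n. (1 - \<theta> * \<tau> n) ^ Suc n * u 0) \<longlonglongrightarrow> exp (- \<theta> * t) * u 0"
    using LIMSEQ_Suc[OF tendsto_exp_limit_sequentially[of "- \<theta> * t"]]
    by (intro tendsto_mult_right) (simp add: \<tau>_def)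
  ultimately have "u t = exp (- \<theta> * t) * u 0" by (rule LIMSEQ_unique)
  then show ?thesis by (simp add: u_def \<theta>_def law_0[OF \<nu>])
qed

lemma reinject_fixed_imp_quasi_stationary:
  assumes \<nu>: "set_pmf \<nu> \<subseteq> L" and fixed: "reinject \<nu> = \<nu>"
  shows "quasi_stationary L \<Delta> P \<nu>"
  unfolding quasi_stationary_def
proof (intro conjI allI impI ballI \<nu>)
  fix t :: real and x assume t: "0 \<le> t" and x: "x \<in> L"
  define c where "c = exp (- (expect \<nu> (\<lambda>x. pmf (J x) \<Delta>) / \<delta>) * t)"
  have c: "pmf (law \<nu> t) z = c * pmf \<nu> z" if "z \<in> L" for z
    using reinject_fixed_decay[OF \<nu> fixed that t] by (simp add: c_def)
  have "1 - pmf (law \<nu> t) \<Delta> = measure (law \<nu> t) (UNIV - {\<Delta>})"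
    using measure_pmf.prob_compl[of "{\<Delta>}" "law \<nu> t"] by (simp add: measure_pmf_single)
  also have "\<dots> = measure (law \<nu> t) L"
    using set_law[OF \<nu> t] notin by (intro measure_pmf.finite_measure_eq_AE) (auto simp: AE_measure_pmf_iff)
  also have "\<dots> = (\<integral>z. pmf (law \<nu> t) z \<partial>count_space L)" by (simp add: integral_pmf)
  also have "\<dots> = (\<integral>z. c * pmf \<nu> z \<partial>count_space L)"
    by (rule Bochner_Integration.integral_cong) (simp_all add: c)
  also have "\<dots> = c * measure \<nu> L" by (simp add: integral_pmf)
  also have "measure \<nu> L = 1"
    using \<nu> by (subst measure_pmf.prob_eq_1) (auto simp: AE_measure_pmf_iff)
  finally show "conditioned_law L \<Delta> P \<nu> t x = pmf \<nu> x"
    using conditioned_law_eq[OF \<nu>, of t x] c[OF x] by (simp add: c_def)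
qed

end

section \<open>A smoothed one-sided distance\<close>

text \<open>The function \<open>soft_pos \<epsilon>\<close> is a Huber-type smoothing of the positive part, and \<open>ramp \<epsilon>\<close> is its
  derivative. It is written in dual form, as the maximum of \<open>r u - \<epsilon> r\<^sup>2 / 2\<close> over
  \<open>0 \<le> r \<le> 1\<close> attained at \<open>r = ramp \<epsilon> u\<close>; the quadratic upper bound then follows from strong
  concavity in \<open>r\<close>.\<close>

definition ramp :: "real \<Rightarrow> real \<Rightarrow> real" where
  "ramp \<epsilon> u = min 1 (max 0 (u / \<epsilon>))"

definition soft_pos :: "real \<Rightarrow> real \<Rightarrow> real" where
  "soft_pos \<epsilon> u = ramp \<epsilon> u * u - \<epsilon> * (ramp \<epsilon> u)\<^sup>2 / 2"

lemma ramp_bounds: "0 \<le> ramp \<epsilon> u" "ramp \<epsilon> u \<le> 1"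
  by (auto simp: ramp_def)

lemma ramp_cases:
  assumes "0 < \<epsilon>"
  obtains "u \<le> 0" "ramp \<epsilon> u = 0" | "0 < u" "u < \<epsilon>" "\<epsilon> * ramp \<epsilon> u = u" | "\<epsilon> \<le> u" "ramp \<epsilon> u = 1"
proof -
  consider "u \<le> 0" | "0 < u" "u < \<epsilon>" | "\<epsilon> \<le> u" by linarith
  then show thesis
  proof cases
    case 1
    then show ?thesis using assms by (intro that(1)) (auto simp: ramp_def max_def zero_le_divide_iff)
  next
    case 2
    then show ?thesis using assms by (intro that(2)) (auto simp: ramp_def)
  next
    case 3
    then show ?thesis using assms by (intro that(3)) (auto simp: ramp_def le_divide_eq max_def)
  qed
qed

text \<open>Optimality of \<open>ramp \<epsilon> u\<close> in the dual problem, with the quadratic gain that strong concavity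
  provides.\<close>

lemma soft_pos_ge:
  assumes "0 < \<epsilon>" "0 \<le> r" "r \<le> 1"
  shows "r * u - \<epsilon> * r\<^sup>2 / 2 + \<epsilon> * (r - ramp \<epsilon> u)\<^sup>2 / 2 \<le> soft_pos \<epsilon> u"
proof -
  let ?s = "ramp \<epsilon> u"
  have "0 \<le> (?s - r) * (u - \<epsilon> * ?s)"
  proof (cases rule: ramp_cases[OF assms(1), of u])
    case 1
    then show ?thesis using assms by (simp add: mult_nonneg_nonpos)
  qed (use assms in auto)
  then show ?thesis
    by (simp add: soft_pos_def power2_eq_square field_simps)
qed

text \<open>The derivative of \<open>soft_pos \<epsilon>\<close> is Lipschitz with constant \<open>1/\<epsilon>\<close>. In the dual form, the increment
  is \<open>d r' - \<epsilon> (r' - r)\<^sup>2 / 2\<close> at most, with \<open>r\<close> and \<open>r'\<close> the old and new maximisers, and completing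
  the square gives the claim.\<close>

lemma soft_pos_add_le:
  assumes "0 < \<epsilon>"
  shows "soft_pos \<epsilon> (u + d) \<le> soft_pos \<epsilon> u + d * ramp \<epsilon> u + d\<^sup>2 / (2 * \<epsilon>)"
proof -
  let ?r = "ramp \<epsilon> (u + d)" and ?s = "ramp \<epsilon> u"
  have "0 \<le> (d - \<epsilon> * (?r - ?s))\<^sup>2 / (2 * \<epsilon>)" using assms by simp
  also have "\<dots> = d\<^sup>2 / (2 * \<epsilon>) - d * (?r - ?s) + \<epsilon> * (?r - ?s)\<^sup>2 / 2"
    using assms by (simp add: power2_eq_square field_simps)
  finally have "d * ?r - d * ?s \<le> d\<^sup>2 / (2 * \<epsilon>) + \<epsilon> * (?r - ?s)\<^sup>2 / 2"
    by (simp add: right_diff_distrib)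
  moreover have "soft_pos \<epsilon> (u + d) = ?r * u + d * ?r - \<epsilon> * ?r\<^sup>2 / 2"
    by (simp add: soft_pos_def algebra_simps)
  ultimately show ?thesis
    using soft_pos_ge[OF assms ramp_bounds[of \<epsilon> "u + d"], of u] by linarith
qed

lemma abs_soft_pos_le:
  assumes "0 < \<epsilon>" "\<bar>u\<bar> \<le> 1" shows "\<bar>soft_pos \<epsilon> u\<bar> \<le> 1 + \<epsilon>"
proof -
  let ?r = "ramp \<epsilon> u"
  have "\<bar>?r * u\<bar> \<le> 1" using ramp_bounds[of \<epsilon> u] assms by (simp add: abs_mult mult_le_one)
  moreover have "?r\<^sup>2 \<le> 1" using ramp_bounds[of \<epsilon> u] by (simp add: power_le_one)
  then have "\<epsilon> * ?r\<^sup>2 \<le> \<epsilon>" "0 \<le> \<epsilon> * ?r\<^sup>2" using assms by (auto simp: mult_left_le)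
  ultimately show ?thesis unfolding soft_pos_def by linarith
qed

definition ramp_test :: "'a set \<Rightarrow> real \<Rightarrow> 'a pmf \<Rightarrow> 'a pmf \<Rightarrow> 'a \<Rightarrow> real" where
  "ramp_test A \<epsilon> \<nu> \<mu> z = (if z \<in> A then ramp \<epsilon> (pmf \<nu> z - pmf \<mu> z) else 0)"

lemma ramp_test_bounds: "0 \<le> ramp_test A \<epsilon> \<nu> \<mu> z" "ramp_test A \<epsilon> \<nu> \<mu> z \<le> 1"
  by (auto simp: ramp_test_def ramp_bounds)

lemma expect_finite_part:
  assumes g: "\<And>z. 0 \<le> g z" "\<And>z. g z \<le> 1" and A: "finite A"
  shows "(\<Sum>z\<in>A. g z * pmf p z) \<le> expect p g"
    and "expect p g \<le> (\<Sum>z\<in>A. g z * pmf p z) + measure (measure_pmf p) (- A)"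
proof -
  have i: "integrable (measure_pmf p) (\<lambda>z. g z * indicator B z)" for B
    using g by (intro integrable_pmf_bounded[where B = 1]) (auto simp: indicator_def)
  have "expect p g = expect p (\<lambda>z. g z * indicator A z + g z * indicator (- A) z)"
    by (rule expect_cong) (simp add: indicator_def)
  also have "\<dots> = expect p (\<lambda>z. g z * indicator A z) + expect p (\<lambda>z. g z * indicator (- A) z)"
    by (rule Bochner_Integration.integral_add[OF i i])
  also have "expect p (\<lambda>z. g z * indicator A z) = (\<Sum>z\<in>A. (g z * indicator A z) * pmf p z)"
    by (rule integral_measure_pmf_real[OF A]) (auto simp: indicator_def split: if_splits)
  also have "\<dots> = (\<Sum>z\<in>A. g z * pmf p z)" by simp
  finally have eq: "expect p g = (\<Sum>z\<in>A. g z * pmf p z) + expect p (\<lambda>z. g z * indicator (- A) z)" .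
  have "0 \<le> expect p (\<lambda>z. g z * indicator (- A) z)"
    using g by (intro Bochner_Integration.integral_nonneg) (simp add: indicator_def)
  with eq show "(\<Sum>z\<in>A. g z * pmf p z) \<le> expect p g" by simp
  have "expect p (\<lambda>z. g z * indicator (- A) z) \<le> expect p (indicator (- A))"
    using g by (intro integral_mono i integrable_pmf_bounded[where B = 1]) (auto simp: indicator_def)
  with eq show "expect p g \<le> (\<Sum>z\<in>A. g z * pmf p z) + measure (measure_pmf p) (- A)" by simp
qed

text \<open>The optimal test function is the indicator of \<open>{\<mu> < \<nu>}\<close>. On \<open>A\<close> the ramp differs from it only where
  \<open>0 < \<nu> - \<mu> < \<epsilon>\<close>, at a cost of at most \<open>\<epsilon>\<close> per site; outside \<open>A\<close> the loss is
  at most the mass of \<open>\<nu>\<close> there, whatever \<open>\<mu>\<close> is.\<close>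

lemma ramp_test_near_optimal:
  fixes \<epsilon> :: real
  assumes A: "finite A" and \<epsilon>: "0 < \<epsilon>"
  shows "tv \<nu> \<mu> - (\<epsilon> * card A + measure (measure_pmf \<nu>) (- A))
    \<le> expect \<nu> (ramp_test A \<epsilon> \<nu> \<mu>) - expect \<mu> (ramp_test A \<epsilon> \<nu> \<mu>)"
proof -
  define B where "B = {z. pmf \<mu> z < pmf \<nu> z}"
  let ?s = "ramp_test A \<epsilon> \<nu> \<mu>"
  define g where "g z = indicator B z - ?s z" for z
  have g: "0 \<le> g z" "g z \<le> 1" and ug: "g z * (pmf \<nu> z - pmf \<mu> z) \<le> \<epsilon>" if "z \<in> A" for z
  proof -
    have "0 \<le> g z \<and> g z \<le> 1 \<and> g z * (pmf \<nu> z - pmf \<mu> z) \<le> \<epsilon>"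
    proof (cases rule: ramp_cases[OF \<epsilon>, of "pmf \<nu> z - pmf \<mu> z"])
      case 2
      let ?u = "pmf \<nu> z - pmf \<mu> z"
      have "g z = 1 - ramp \<epsilon> ?u" using 2 that by (simp add: g_def B_def ramp_test_def)
      moreover have "(1 - ramp \<epsilon> ?u) * ?u \<le> 1 * ?u"
        using 2 ramp_bounds[of \<epsilon> ?u] by (intro mult_right_mono) auto
      then have "(1 - ramp \<epsilon> ?u) * ?u \<le> \<epsilon>"
        by (rule order_trans) (use 2 in simp)
      ultimately show ?thesis using 2 ramp_bounds[of \<epsilon> ?u] by simp
    qed (use \<epsilon> that in \<open>auto simp: g_def B_def ramp_test_def indicator_def\<close>)
    then show "0 \<le> g z" "g z \<le> 1" "g z * (pmf \<nu> z - pmf \<mu> z) \<le> \<epsilon>" by auto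
  qed
  have g: "0 \<le> g z" "g z \<le> 1" for z
    using g[of z] by (cases "z \<in> A"; simp add: g_def ramp_test_def indicator_def)+
  have eg: "expect p g = measure (measure_pmf p) B - expect p ?s" for p
    unfolding g_def
    by (subst Bochner_Integration.integral_diff)
      (auto intro!: integrable_pmf_bounded[where B = 1] simp: ramp_test_bounds)
  have "expect \<nu> g - expect \<mu> g \<le>
      (\<Sum>z\<in>A. g z * pmf \<nu> z) + measure (measure_pmf \<nu>) (- A) - (\<Sum>z\<in>A. g z * pmf \<mu> z)"
    using expect_finite_part(1)[where g = g and p = \<mu>, OF g A]
      expect_finite_part(2)[where g = g and p = \<nu>, OF g A] by linarith
  also have "\<dots> = (\<Sum>z\<in>A. g z * (pmf \<nu> z - pmf \<mu> z)) + measure (measure_pmf \<nu>) (- A)"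
    by (simp add: sum_subtractf right_diff_distrib)
  also have "(\<Sum>z\<in>A. g z * (pmf \<nu> z - pmf \<mu> z)) \<le> (\<Sum>z\<in>A. \<epsilon>)"
    by (rule sum_mono) (rule ug)
  finally show ?thesis
    by (simp add: eg tv_def Let_def B_def[symmetric] mult.commute)
qed

section \<open>The empirical measure of a configuration\<close>

definition empirical :: "nat \<Rightarrow> (nat \<Rightarrow> 's) \<Rightarrow> 's pmf" where
  "empirical N \<xi> = map_pmf \<xi> (pmf_of_set {1..N})"

lemma pmf_map_of_set:
  assumes "finite I" "I \<noteq> {}"
  shows "pmf (map_pmf \<xi> (pmf_of_set I)) x = card {i \<in> I. \<xi> i = x} / card I"
proof -
  have "I \<inter> \<xi> -` {x} = {i \<in> I. \<xi> i = x}" by auto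
  then show ?thesis using assms by (simp add: pmf_map measure_pmf_of_set)
qed

lemma pmf_empirical: "0 < N \<Longrightarrow> pmf (empirical N \<xi>) x = real (occupation N \<xi> x) / real N"
  by (simp add: empirical_def pmf_map_of_set occupation_def)

lemma expect_empirical: "0 < N \<Longrightarrow> expect (empirical N \<xi>) f = (\<Sum>i=1..N. f (\<xi> i)) / real N"
  by (simp add: empirical_def integral_pmf_of_set)

lemma configs_mem: "\<xi> \<in> configs L N \<Longrightarrow> i \<in> {1..N} \<Longrightarrow> \<xi> i \<in> L"
  by (auto simp: configs_def)

lemma set_empirical: "\<xi> \<in> configs L N \<Longrightarrow> 0 < N \<Longrightarrow> set_pmf (empirical N \<xi>) \<subseteq> L"
  using configs_mem by (fastforce simp: empirical_def)

lemma occupation_update: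
  assumes "i \<in> {1..N}"
  shows "real (occupation N (\<xi>(i := y)) z) = real (occupation N \<xi> z) + indicator {y} z - indicator {\<xi> i} z"
proof -
  have split: "real (occupation N \<zeta> z) = real (card {j \<in> {1..N} - {i}. \<zeta> j = z}) + indicator {\<zeta> i} z" for \<zeta> :: "nat \<Rightarrow> 'a"
  proof -
    have "{j \<in> {1..N}. \<zeta> j = z} = {j \<in> {1..N} - {i}. \<zeta> j = z} \<union> (if \<zeta> i = z then {i} else {})"
      using assms by auto
    then have "occupation N \<zeta> z = card {j \<in> {1..N} - {i}. \<zeta> j = z} + card (if \<zeta> i = z then {i} else {})"
      unfolding occupation_def by (simp only:) (rule card_Un_disjoint, auto)
    then show ?thesis by (simp add: indicator_def)
  qed
  have "{j \<in> {1..N} - {i}. (\<xi>(i := y)) j = z} = {j \<in> {1..N} - {i}. \<xi> j = z}" by auto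
  then show ?thesis using split[of "\<xi>(i := y)"] split[of \<xi>] by simp
qed

section \<open>The Fleming--Viot generator\<close>

context bounded_killed_rates
begin

definition others :: "nat \<Rightarrow> (nat \<Rightarrow> 's) \<Rightarrow> nat \<Rightarrow> 's pmf" where
  "others N \<xi> i = map_pmf \<xi> (pmf_of_set ({1..N} - {i}))"

lemma others_index:
  assumes "2 \<le> N" shows "{1..N::nat} - {i} \<noteq> {}"
proof
  assume "{1..N} - {i} = {}"
  then have "{1..N} \<subseteq> {i}" by blast
  moreover have "1 \<in> {1..N}" "2 \<in> {1..N}" using assms by auto
  ultimately have "1 = i" "2 = i" by blast+
  then show False by simp
qed

lemma set_others:
  assumes "\<xi> \<in> configs L N" "2 \<le> N" shows "set_pmf (others N \<xi> i) \<subseteq> L"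
  using configs_mem[OF assms(1)] others_index[OF assms(2)] by (auto simp: others_def)

lemma pmf_redraw:
  assumes "z \<noteq> \<Delta>"
  shows "pmf (redraw \<mu> x) z = pmf (J x) z + pmf (J x) \<Delta> * pmf \<mu> z"
proof -
  have "(\<lambda>y. if y = \<Delta> then 0 else indicator {z} y) = (indicator {z} :: 's \<Rightarrow> real)"
    using assms by (auto simp: indicator_def)
  then show ?thesis
    using expect_redraw[of "indicator {z}" 1 \<mu>] by (simp add: measure_pmf_single)
qed

text \<open>After multiplication by \<open>\<delta>\<close>, the rate at which particle \<open>i\<close> jumps to \<open>y\<close> is the probability that one
  reinjected step from \<open>\<xi> i\<close>, redrawing from the other particles, ends in \<open>y\<close>. This turns
  the infinite sums of rates into expectations.\<close>

lemma generator_eq: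
  assumes \<xi>: "\<xi> \<in> configs L N" and N: "2 \<le> N" and f: "\<And>\<zeta>. \<bar>f \<zeta>\<bar> \<le> B"
  shows "\<delta> * fv_generator L \<Delta> q N f \<xi> =
    (\<Sum>i=1..N. expect (redraw (others N \<xi> i) (\<xi> i)) (\<lambda>y. f (\<xi>(i := y))) - f \<xi>)"
  unfolding fv_generator_def sum_distrib_left
proof (rule sum.cong[OF refl])
  fix i assume i: "i \<in> {1..N}"
  let ?x = "\<xi> i" and ?R = "redraw (others N \<xi> i) (\<xi> i)"
  let ?r = "\<lambda>y. q ?x y + q ?x \<Delta> * (real (occupation N \<xi> y) / (real N - 1))"
  define D where "D y = f (\<xi>(i := y)) - f \<xi>" for y
  have x: "?x \<in> L" by (rule configs_mem[OF \<xi> i])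
  have D: "\<bar>D y\<bar> \<le> 2 * B" for y using f[of "\<xi>(i := y)"] f[of \<xi>] unfolding D_def by linarith
  have R: "set_pmf ?R \<subseteq> L" by (rule set_redraw[OF set_others[OF \<xi> N] x])
  have rate: "\<delta> * ?r y = pmf ?R y" if "y \<in> L - {?x}" for y
  proof -
    have y: "y \<noteq> \<Delta>" "y \<noteq> ?x" "y \<in> L" "\<Delta> \<noteq> ?x" using that notin x by auto
    have "{j \<in> {1..N} - {i}. \<xi> j = y} = {j \<in> {1..N}. \<xi> j = y}" using y by auto
    moreover have "real (card ({1..N} - {i})) = real N - 1" using i N by simp
    ultimately have "pmf (others N \<xi> i) y = real (occupation N \<xi> y) / (real N - 1)"
      unfolding others_def occupation_def by (subst pmf_map_of_set) (use others_index[OF N] in auto)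
    then show ?thesis
      using y x by (simp add: pmf_redraw pmf_J[OF x] J_absorption[OF x] indicator_def algebra_simps)
  qed
  have "\<delta> * (\<Sum>\<^sub>\<infinity>y\<in>L - {?x}. ?r y * D y) = (\<Sum>\<^sub>\<infinity>y\<in>L - {?x}. \<delta> * (?r y * D y))"
    by (rule infsum_cmult_right'[symmetric])
  also have "\<dots> = (\<Sum>\<^sub>\<infinity>y\<in>L - {?x}. pmf ?R y * D y)"
    by (rule infsum_cong) (simp only: rate[symmetric] mult.assoc)
  also have "\<dots> = (\<Sum>\<^sub>\<infinity>y\<in>L. pmf ?R y * D y)"
    by (rule infsum_cong_neutral) (auto simp: D_def)
  also have "\<dots> = expect ?R D"
    by (rule infsum_pmf_eq_expect[OF R D])
  also have "\<dots> = expect ?R (\<lambda>y. f (\<xi>(i := y))) - f \<xi>"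
    unfolding D_def using integrable_pmf_bounded[of "\<lambda>y. f (\<xi>(i := y))" B ?R] f by simp
  finally show "\<delta> * (\<Sum>\<^sub>\<infinity>y\<in>L - {?x}. ?r y * (f (\<xi>(i := y)) - f \<xi>)) =
      expect ?R (\<lambda>y. f (\<xi>(i := y))) - f \<xi>" by (simp add: D_def)
qed

lemma generator_bounded:
  assumes \<xi>: "\<xi> \<in> configs L N" and N: "2 \<le> N" and f: "\<And>\<zeta>. \<bar>f \<zeta>\<bar> \<le> B"
  shows "\<bar>fv_generator L \<Delta> q N f \<xi>\<bar> \<le> real N * (2 * B) / \<delta>"
proof -
  have "\<delta> * \<bar>fv_generator L \<Delta> q N f \<xi>\<bar> = \<bar>\<delta> * fv_generator L \<Delta> q N f \<xi>\<bar>"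
    using \<delta> by (simp add: abs_mult)
  also have "\<dots> \<le> (\<Sum>i=1..N. \<bar>expect (redraw (others N \<xi> i) (\<xi> i)) (\<lambda>y. f (\<xi>(i := y))) - f \<xi>\<bar>)"
    unfolding generator_eq[OF \<xi> N f] by (rule sum_abs)
  also have "\<dots> \<le> (\<Sum>i=1..N. 2 * B)"
  proof (rule sum_mono)
    fix i
    show "\<bar>expect (redraw (others N \<xi> i) (\<xi> i)) (\<lambda>y. f (\<xi>(i := y))) - f \<xi>\<bar> \<le> 2 * B"
      using abs_expect_le[of "\<lambda>y. f (\<xi>(i := y))" B "redraw (others N \<xi> i) (\<xi> i)", OF f] f[of \<xi>]
      by linarith
  qed
  finally show ?thesis using \<delta> by (simp add: field_simps)
qed

lemma fv_leaving_le:
  assumes N: "2 \<le> N" and S: "fv_semigroup L \<Delta> q N S" and \<xi>: "\<xi> \<in> configs L N" and t: "0 \<le> t"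
  shows "1 - pmf (S t \<xi>) \<xi> \<le> real N * 2 / \<delta> * t"
proof (rule leaving_prob_le)
  let ?f = "indicator {\<xi>} :: (nat \<Rightarrow> 's) \<Rightarrow> real"
  show "markov_semigroup (configs L N) S" using S by (simp add: fv_semigroup_def)
  have "bounded (range ?f)"
    by (rule boundedI[where B = 1]) (auto simp: indicator_def)
  then have "((\<lambda>t. expect (S t \<xi>) ?f) has_real_derivative fv_generator L \<Delta> q N ?f \<xi>) (at 0 within {0..})"
    using S \<xi> by (simp only: fv_semigroup_def)
  then show "((\<lambda>t. pmf (S t \<xi>) \<xi>) has_real_derivative fv_generator L \<Delta> q N ?f \<xi>) (at 0 within {0..})"
    by (simp add: measure_pmf_single)
  show "- fv_generator L \<Delta> q N ?f \<xi> \<le> real N * 2 / \<delta>"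
    using generator_bounded[OF \<xi> N, of ?f 1] by (simp add: indicator_def abs_le_iff)
qed fact+

text \<open>Invariance makes the mean of \<open>S\<^sub>t f - f\<close> vanish for every \<open>t\<close>; the generator is the limit of
  \<open>(S\<^sub>t f - f) / t\<close>, and these quotients are bounded by \<open>fv_leaving_le\<close>.\<close>

lemma invariant_generator_zero:
  assumes N: "2 \<le> N" and S: "fv_semigroup L \<Delta> q N S"
    and \<rho>: "invariant_law (configs L N) S \<rho>" and f: "\<And>\<zeta>. \<bar>f \<zeta>\<bar> \<le> B"
  shows "expect \<rho> (fv_generator L \<Delta> q N f) = 0"
proof -
  define \<tau> where "\<tau> n = 1 / real (Suc n)" for n
  have \<tau>: "0 < \<tau> n" "\<tau> \<longlonglongrightarrow> 0" for n
    using LIMSEQ_Suc[OF lim_const_over_n[of 1]] unfolding \<tau>_def by simp_all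
  have B: "0 \<le> B" using order_trans[OF abs_ge_zero f] .
  have \<rho>c: "\<xi> \<in> configs L N" if "\<xi> \<in> set_pmf \<rho>" for \<xi>
    using \<rho> that by (auto simp: invariant_law_def)
  have S0: "S 0 \<xi> = return_pmf \<xi>" if "\<xi> \<in> configs L N" for \<xi>
    using S that by (simp only: fv_semigroup_def markov_semigroup_def)
  have "bounded (range f)" by (rule boundedI[where B = B]) (use f in auto)
  then have der: "((\<lambda>t. expect (S t \<xi>) f) has_real_derivative fv_generator L \<Delta> q N f \<xi>) (at 0 within {0..})"
    if "\<xi> \<in> configs L N" for \<xi>
    using S that by (simp only: fv_semigroup_def)
  have lim: "(\<lambda>n. expect \<rho> (\<lambda>\<xi>. (expect (S (\<tau> n) \<xi>) f - f \<xi>) / \<tau> n)) \<longlonglongrightarrow> expect \<rho> (fv_generator L \<Delta> q N f)"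
  proof (rule integral_dominated_convergence[where w = "\<lambda>_. 2 * B * (real N * 2 / \<delta>)"])
    show "AE \<xi> in measure_pmf \<rho>. (\<lambda>n. (expect (S (\<tau> n) \<xi>) f - f \<xi>) / \<tau> n) \<longlonglongrightarrow> fv_generator L \<Delta> q N f \<xi>"
      unfolding AE_measure_pmf_iff
    proof
      fix \<xi> assume "\<xi> \<in> set_pmf \<rho>"
      then show "(\<lambda>n. (expect (S (\<tau> n) \<xi>) f - f \<xi>) / \<tau> n) \<longlonglongrightarrow> fv_generator L \<Delta> q N f \<xi>"
        using right_derivative_sequentially[OF der \<tau>] \<rho>c S0 by fastforce
    qed
    show "AE \<xi> in measure_pmf \<rho>. norm ((expect (S (\<tau> n) \<xi>) f - f \<xi>) / \<tau> n) \<le> 2 * B * (real N * 2 / \<delta>)" for n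
      unfolding AE_measure_pmf_iff
    proof
      fix \<xi> assume "\<xi> \<in> set_pmf \<rho>"
      have "\<bar>expect (S (\<tau> n) \<xi>) f - f \<xi>\<bar> \<le> 2 * B * (1 - pmf (S (\<tau> n) \<xi>) \<xi>)"
        by (rule expect_change_le[OF f])
      also have "\<dots> \<le> 2 * B * (real N * 2 / \<delta> * \<tau> n)"
        using fv_leaving_le[OF N S \<rho>c[OF \<open>\<xi> \<in> set_pmf \<rho>\<close>] less_imp_le[OF \<tau>(1)]] B
        by (intro mult_left_mono) auto
      finally show "norm ((expect (S (\<tau> n) \<xi>) f - f \<xi>) / \<tau> n) \<le> 2 * B * (real N * 2 / \<delta>)"
        using \<tau>(1)[of n] by (simp add: abs_divide divide_le_eq mult.assoc)
    qed
  qed auto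
  have zero: "expect \<rho> (\<lambda>\<xi>. (expect (S (\<tau> n) \<xi>) f - f \<xi>) / \<tau> n) = 0" for n
  proof -
    have "expect \<rho> (\<lambda>\<xi>. expect (S (\<tau> n) \<xi>) f) = expect (bind_pmf \<rho> (S (\<tau> n))) f"
      by (rule expect_bind[OF f, symmetric])
    also have "\<dots> = expect \<rho> f"
      using \<rho> less_imp_le[OF \<tau>(1)] by (simp add: invariant_law_def)
    finally show ?thesis
      using integrable_pmf_bounded[OF f, of \<rho>] integrable_pmf_bounded[OF abs_expect_le[OF f], of \<rho> "S (\<tau> n)"]
      by simp
  qed
  from lim show ?thesis unfolding zero by (simp add: LIMSEQ_const_iff)
qed

section \<open>The Lyapunov function\<close>

definition lyapunov :: "'s set \<Rightarrow> real \<Rightarrow> 's pmf \<Rightarrow> nat \<Rightarrow> (nat \<Rightarrow> 's) \<Rightarrow> real" where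
  "lyapunov A \<epsilon> \<nu> N \<xi> = (\<Sum>z\<in>A. soft_pos \<epsilon> (pmf \<nu> z - pmf (empirical N \<xi>) z))"

lemma abs_lyapunov_le:
  fixes \<epsilon> :: real
  assumes "0 < \<epsilon>" shows "\<bar>lyapunov A \<epsilon> \<nu> N \<xi>\<bar> \<le> card A * (1 + \<epsilon>)"
proof -
  have "\<bar>pmf \<nu> z - pmf \<mu> z\<bar> \<le> 1" for z and \<mu> :: "'s pmf"
    using pmf_le_1[of \<nu> z] pmf_le_1[of \<mu> z] pmf_nonneg[of \<nu> z] pmf_nonneg[of \<mu> z] by linarith
  then have "\<bar>lyapunov A \<epsilon> \<nu> N \<xi>\<bar> \<le> (\<Sum>z\<in>A. 1 + \<epsilon>)"
    unfolding lyapunov_def by (intro order_trans[OF sum_abs] sum_mono abs_soft_pos_le assms)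
  then show ?thesis by simp
qed

text \<open>A jump from \<open>\<xi> i\<close> to \<open>y\<close> raises the deficit \<open>\<nu> - \<pi>\<close> by \<open>1/N\<close> at \<open>\<xi> i\<close> and lowers it by
  \<open>1/N\<close> at \<open>y\<close>. The first-order change is read off from the ramp; the second-order terms of these two sites
  are at most \<open>1/(2 \<epsilon> N\<^sup>2)\<close> each. The case \<open>y = \<xi> i\<close> needs no special treatment.\<close>

lemma lyapunov_jump_le:
  fixes \<nu> :: "'s pmf" and \<xi> :: "nat \<Rightarrow> 's"
  assumes A: "finite A" and \<epsilon>: "0 < \<epsilon>" and i: "i \<in> {1..N}"
  defines "s \<equiv> ramp_test A \<epsilon> \<nu> (empirical N \<xi>)"
  shows "lyapunov A \<epsilon> \<nu> N (\<xi>(i := y)) - lyapunov A \<epsilon> \<nu> N \<xi> \<le> (s (\<xi> i) - s y) / N + 1 / (\<epsilon> * (real N)\<^sup>2)"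
proof -
  have N: "0 < N" using i by auto
  define u where "u z = pmf \<nu> z - pmf (empirical N \<xi>) z" for z
  define d :: "'s \<Rightarrow> real" where "d z = (indicator {\<xi> i} z - indicator {y} z) / N" for z
  have new: "pmf \<nu> z - pmf (empirical N (\<xi>(i := y))) z = u z + d z" for z
    using N by (simp add: u_def d_def pmf_empirical occupation_update[OF i] diff_divide_distrib add_divide_distrib)
  have pick: "(\<Sum>z\<in>A. indicator {x} z * g z) = (if x \<in> A then g x else 0)" for x and g :: "'s \<Rightarrow> real"
  proof -
    have "(\<Sum>z\<in>A. indicator {x} z * g z) = (\<Sum>z\<in>A. if z = x then g x else 0)"
      by (rule sum.cong) (auto simp: indicator_def)
    then show ?thesis using A by simp
  qed
  have s_off: "(if x \<in> A then s x else 0) = s x" for x by (simp add: s_def ramp_test_def)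
  have lin: "(\<Sum>z\<in>A. d z * s z) = (s (\<xi> i) - s y) / N"
    unfolding d_def by (simp add: sum_subtractf left_diff_distrib pick s_off flip: sum_divide_distrib)
  have "(\<Sum>z\<in>A. (d z)\<^sup>2) \<le> (\<Sum>z\<in>A. (indicator {\<xi> i} z + indicator {y} z) / (real N)\<^sup>2)"
    by (rule sum_mono) (auto simp: d_def indicator_def power_divide)
  also have "\<dots> = ((\<Sum>z\<in>A. indicator {\<xi> i} z) + (\<Sum>z\<in>A. indicator {y} z)) / (real N)\<^sup>2"
    by (simp add: sum.distrib flip: sum_divide_distrib)
  also have "\<dots> \<le> (1 + 1) / (real N)\<^sup>2"
  proof -
    have "(\<Sum>z\<in>A. indicator {x} z) \<le> (1::real)" for x
      using pick[of x "\<lambda>_. 1"] by (cases "x \<in> A") auto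
    then show ?thesis by (intro divide_right_mono add_mono) auto
  qed
  finally have quad: "(\<Sum>z\<in>A. (d z)\<^sup>2) \<le> 2 / (real N)\<^sup>2" by simp
  have "lyapunov A \<epsilon> \<nu> N (\<xi>(i := y)) - lyapunov A \<epsilon> \<nu> N \<xi>
      = (\<Sum>z\<in>A. soft_pos \<epsilon> (u z + d z) - soft_pos \<epsilon> (u z))"
    unfolding lyapunov_def new by (simp add: sum_subtractf u_def)
  also have "\<dots> \<le> (\<Sum>z\<in>A. d z * s z + (d z)\<^sup>2 / (2 * \<epsilon>))"
  proof (rule sum_mono)
    fix z assume "z \<in> A"
    then show "soft_pos \<epsilon> (u z + d z) - soft_pos \<epsilon> (u z) \<le> d z * s z + (d z)\<^sup>2 / (2 * \<epsilon>)"
      using soft_pos_add_le[OF \<epsilon>, of "u z" "d z"] by (simp add: s_def ramp_test_def u_def)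
  qed
  also have "\<dots> = (s (\<xi> i) - s y) / N + (\<Sum>z\<in>A. (d z)\<^sup>2) / (2 * \<epsilon>)"
    by (simp add: sum.distrib lin sum_divide_distrib)
  also have "(\<Sum>z\<in>A. (d z)\<^sup>2) / (2 * \<epsilon>) \<le> (2 / (real N)\<^sup>2) / (2 * \<epsilon>)"
    using quad \<epsilon> by (intro divide_right_mono) auto
  also have "\<dots> = 1 / (\<epsilon> * (real N)\<^sup>2)" by (simp add: mult.commute)
  finally show ?thesis by linarith
qed

lemma expect_others_ge:
  assumes N: "2 \<le> N" and i: "i \<in> {1..N}" and s: "\<And>z. 0 \<le> s z" "\<And>z. s z \<le> 1"
  shows "expect (empirical N \<xi>) s - 1 / N \<le> expect (others N \<xi> i) s"
proof -
  define m where "m = expect (others N \<xi> i) s"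
  have "real (card ({1..N} - {i})) = real N - 1" using i N by simp
  then have "m = (\<Sum>j\<in>{1..N} - {i}. s (\<xi> j)) / (real N - 1)"
    using others_index[OF N] by (simp add: m_def others_def integral_pmf_of_set)
  then have "(\<Sum>j\<in>{1..N} - {i}. s (\<xi> j)) = (real N - 1) * m" using N by simp
  then have "expect (empirical N \<xi>) s = (s (\<xi> i) + (real N - 1) * m) / N"
    using N sum.remove[OF _ i, of "\<lambda>j. s (\<xi> j)"] by (simp add: expect_empirical)
  moreover have "0 \<le> m" using s expect_bounds(1)[of "others N \<xi> i" 0 s 1] by (simp add: m_def)
  ultimately show ?thesis using N s(2)[of "\<xi> i"] by (simp add: m_def[symmetric] field_simps)
qed

text \<open>Summing the jump bound over the particles, the first-order terms become
  \<open>\<pi>(s) - (F \<pi>)(s)\<close> for the ramp test function \<open>s\<close>, up to \<open>1/N\<close> for redrawing from the other particles,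
  and the second-order terms add up to \<open>1/(\<epsilon> N)\<close>. The drift inequality of the mean-field chain
  bounds the former.\<close>

lemma generator_lyapunov_le:
  fixes \<epsilon> :: real
  assumes A: "finite A" and \<epsilon>: "0 < \<epsilon>" and \<xi>: "\<xi> \<in> configs L N" and N: "2 \<le> N"
    and \<nu>: "set_pmf \<nu> \<subseteq> L" "reinject \<nu> = \<nu>"
  shows "\<delta> * fv_generator L \<Delta> q N (lyapunov A \<epsilon> \<nu> N) \<xi> \<le>
    \<epsilon> * card A + measure (measure_pmf \<nu>) (- A) + (1 + 1 / \<epsilon>) / N
      - \<delta> * (sum a F - C) * tv \<nu> (empirical N \<xi>)"
proof -
  let ?\<pi> = "empirical N \<xi>" and ?V = "lyapunov A \<epsilon> \<nu> N"
  define s where "s = ramp_test A \<epsilon> \<nu> ?\<pi>"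
  define Js where "Js x = expect (J x) (\<lambda>y. if y = \<Delta> then 0 else s y)" for x
  have s: "0 \<le> s z" "s z \<le> 1" and s1: "\<bar>s z\<bar> \<le> 1" for z
    using ramp_test_bounds[of A \<epsilon> \<nu> ?\<pi> z] by (auto simp: s_def)
  have N0: "0 < N" using N by simp
  have "\<delta> * fv_generator L \<Delta> q N ?V \<xi> \<le>
      (\<Sum>i=1..N. (s (\<xi> i) - (Js (\<xi> i) + pmf (J (\<xi> i)) \<Delta> * expect ?\<pi> s - 1 / N)) / N + 1 / (\<epsilon> * (real N)\<^sup>2))"
    unfolding generator_eq[OF \<xi> N abs_lyapunov_le[OF \<epsilon>]]
  proof (rule sum_mono)
    fix i assume i: "i \<in> {1..N}"
    let ?R = "redraw (others N \<xi> i) (\<xi> i)"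
    have iV: "integrable (measure_pmf ?R) (\<lambda>y. ?V (\<xi>(i := y)))"
      by (rule integrable_pmf_bounded[OF abs_lyapunov_le[OF \<epsilon>]])
    have int_s: "integrable (measure_pmf ?R) s" by (rule integrable_pmf_bounded[OF s1])
    have "expect ?R (\<lambda>y. ?V (\<xi>(i := y))) - ?V \<xi> = expect ?R (\<lambda>y. ?V (\<xi>(i := y)) - ?V \<xi>)"
      using iV by simp
    also have "\<dots> \<le> expect ?R (\<lambda>y. (s (\<xi> i) - s y) / N + 1 / (\<epsilon> * (real N)\<^sup>2))"
      using lyapunov_jump_le[OF A \<epsilon> i, of \<nu> \<xi>] iV int_s
      by (intro integral_mono) (auto simp: s_def)
    also have "\<dots> = (s (\<xi> i) - expect ?R s) / N + 1 / (\<epsilon> * (real N)\<^sup>2)"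
      using int_s by simp
    also have "\<dots> \<le> (s (\<xi> i) - (Js (\<xi> i) + pmf (J (\<xi> i)) \<Delta> * expect ?\<pi> s - 1 / N)) / N + 1 / (\<epsilon> * (real N)\<^sup>2)"
    proof -
      have "pmf (J (\<xi> i)) \<Delta> * (expect ?\<pi> s - 1 / N) \<le> pmf (J (\<xi> i)) \<Delta> * expect (others N \<xi> i) s"
        by (intro mult_left_mono expect_others_ge N i s) simp
      moreover have "pmf (J (\<xi> i)) \<Delta> * (1 / N) \<le> 1 / N"
        by (intro mult_left_le_one_le) (auto simp: pmf_le_1)
      ultimately have "Js (\<xi> i) + pmf (J (\<xi> i)) \<Delta> * expect ?\<pi> s - 1 / N \<le> expect ?R s"
        unfolding expect_redraw[OF s1] Js_def[symmetric] by (simp add: algebra_simps)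
      then show ?thesis by (intro add_right_mono divide_right_mono) auto
    qed
    finally show "expect ?R (\<lambda>y. ?V (\<xi>(i := y))) - ?V \<xi> \<le> \<dots>" .
  qed
  also have "\<dots> = expect ?\<pi> s - (expect ?\<pi> Js + expect ?\<pi> (\<lambda>x. pmf (J x) \<Delta>) * expect ?\<pi> s)
      + 1 / N + 1 / (\<epsilon> * N)"
  proof -
    let ?p = "\<lambda>x. pmf (J x) \<Delta>" and ?c = "1 / (\<epsilon> * (real N)\<^sup>2)"
    have "(\<Sum>i=1..N. (s (\<xi> i) - (Js (\<xi> i) + ?p (\<xi> i) * expect ?\<pi> s - 1 / N)) / N + ?c)
        = (\<Sum>i=1..N. s (\<xi> i) / N - (Js (\<xi> i) / N + ?p (\<xi> i) / N * expect ?\<pi> s) + (1 / N / N + ?c))"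
      by (rule sum.cong) (auto simp: diff_divide_distrib add_divide_distrib)
    also have "\<dots> = (\<Sum>i=1..N. s (\<xi> i) / N)
        - ((\<Sum>i=1..N. Js (\<xi> i) / N) + (\<Sum>i=1..N. ?p (\<xi> i) / N) * expect ?\<pi> s) + (real N * (1 / N / N) + real N * ?c)"
      by (simp only: sum.distrib sum_subtractf sum_distrib_right sum_constant card_atLeastAtMost) simp
    also have "real N * (1 / N / N) + real N * ?c = 1 / N + 1 / (\<epsilon> * N)"
      using N0 \<epsilon> by (simp add: field_simps power2_eq_square)
    finally show ?thesis
      by (simp only: expect_empirical[OF N0] sum_divide_distrib add.assoc)
  qed
  also have "expect ?\<pi> Js + expect ?\<pi> (\<lambda>x. pmf (J x) \<Delta>) * expect ?\<pi> s = expect (reinject ?\<pi>) s"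
    unfolding expect_reinject[OF s1] Js_def ..
  also have "expect ?\<pi> s - expect (reinject ?\<pi>) s \<le>
      \<epsilon> * card A + measure (measure_pmf \<nu>) (- A) - \<delta> * (sum a F - C) * tv \<nu> ?\<pi>"
    using drift_towards_fixed_point[OF \<nu> set_empirical[OF \<xi> N0] s ramp_test_near_optimal[OF A \<epsilon>, of \<nu> ?\<pi>, folded s_def]]
      \<epsilon> by (simp add: spectral_gap)
  finally show ?thesis by (simp add: add_divide_distrib)
qed

section \<open>Convergence of the stationary empirical measures\<close>

lemma invariant_tv_le:
  fixes \<epsilon> :: real
  assumes A: "finite A" and \<epsilon>: "0 < \<epsilon>" and N: "2 \<le> N" and S: "fv_semigroup L \<Delta> q N S"
    and \<rho>: "invariant_law (configs L N) S \<rho>" and \<nu>: "set_pmf \<nu> \<subseteq> L" "reinject \<nu> = \<nu>"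
  shows "\<delta> * (sum a F - C) * expect \<rho> (\<lambda>\<xi>. tv \<nu> (empirical N \<xi>)) \<le>
    \<epsilon> * card A + measure (measure_pmf \<nu>) (- A) + (1 + 1 / \<epsilon>) / N"
proof -
  define G where "G = fv_generator L \<Delta> q N (lyapunov A \<epsilon> \<nu> N)"
  define c where "c = \<epsilon> * card A + measure (measure_pmf \<nu>) (- A) + (1 + 1 / \<epsilon>) / N"
  let ?tv = "\<lambda>\<xi>. tv \<nu> (empirical N \<xi>)"
  have \<rho>c: "\<xi> \<in> configs L N" if "\<xi> \<in> set_pmf \<rho>" for \<xi>
    using \<rho> that by (auto simp: invariant_law_def)
  have itv: "integrable (measure_pmf \<rho>) ?tv"
    by (rule integrable_pmf_bounded[where B = 1]) (simp add: tv_nonneg tv_le_1)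
  have iG: "integrable (measure_pmf \<rho>) G"
    by (rule measure_pmf.integrable_const_bound[where B = "real N * (2 * (card A * (1 + \<epsilon>))) / \<delta>"])
      (use generator_bounded[OF \<rho>c N abs_lyapunov_le[OF \<epsilon>]] in \<open>auto simp: AE_measure_pmf_iff G_def\<close>)
  have "0 = \<delta> * expect \<rho> G"
    using invariant_generator_zero[where f = "lyapunov A \<epsilon> \<nu> N", OF N S \<rho> abs_lyapunov_le[OF \<epsilon>]]
    by (simp add: G_def)
  also have "\<dots> = expect \<rho> (\<lambda>\<xi>. \<delta> * G \<xi>)" by simp
  also have "\<dots> \<le> expect \<rho> (\<lambda>\<xi>. c - \<delta> * (sum a F - C) * ?tv \<xi>)"
    using generator_lyapunov_le[OF A \<epsilon> \<rho>c N \<nu>] iG itv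
    by (intro integral_mono_AE) (auto simp: AE_measure_pmf_iff G_def c_def)
  also have "\<dots> = c - \<delta> * (sum a F - C) * expect \<rho> ?tv" using itv by simp
  finally show ?thesis by (simp add: c_def)
qed

text \<open>The parameters are chosen in this order: first \<open>A\<close> to make \<open>\<nu>(L - A)\<close> small, then \<open>\<epsilon>\<close> depending on the
  size of \<open>A\<close>, and finally \<open>N\<close>.\<close>

lemma invariant_tv_tendsto_0:
  assumes S: "\<And>N. 2 \<le> N \<Longrightarrow> fv_semigroup L \<Delta> q N (S N)"
    and \<rho>: "\<And>N. 2 \<le> N \<Longrightarrow> invariant_law (configs L N) (S N) (\<rho> N)"
    and \<nu>: "set_pmf \<nu> \<subseteq> L" "reinject \<nu> = \<nu>"
  shows "(\<lambda>N. expect (\<rho> N) (\<lambda>\<xi>. tv \<nu> (empirical N \<xi>))) \<longlonglongrightarrow> 0"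
proof (rule LIMSEQ_I)
  fix e :: real assume e: "0 < e"
  define g where "g = \<delta> * (sum a F - C)"
  have g: "0 < g" using \<delta> C_less by (simp add: g_def)
  define \<eta> where "\<eta> = g * e / 4"
  have \<eta>: "0 < \<eta>" using g e by (simp add: \<eta>_def)
  obtain A where A: "finite A" "measure \<nu> UNIV - \<eta> < measure \<nu> A"
    using finite_measure_approx[OF \<eta>, of UNIV \<nu>] by auto
  have "measure \<nu> (- A) = 1 - measure \<nu> A"
    using measure_pmf.prob_compl[of A \<nu>] by (simp add: Compl_eq_Diff_UNIV)
  then have \<nu>A: "measure \<nu> (- A) < \<eta>" using A by simp
  define \<epsilon> where "\<epsilon> = \<eta> / (card A + 1)"
  have \<epsilon>: "0 < \<epsilon>" "\<epsilon> * card A \<le> \<eta>" using \<eta> by (auto simp: \<epsilon>_def field_simps)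
  have "(\<lambda>N. (1 + 1 / \<epsilon>) / real N) \<longlonglongrightarrow> 0" by (rule lim_const_over_n)
  then have "\<forall>\<^sub>F N in sequentially. (1 + 1 / \<epsilon>) / real N < \<eta>"
    using \<eta> by (rule order_tendstoD)
  then obtain N0 where N0: "\<And>N. N \<ge> N0 \<Longrightarrow> (1 + 1 / \<epsilon>) / real N < \<eta>"
    by (auto simp: eventually_sequentially)
  show "\<exists>no. \<forall>N\<ge>no. norm (expect (\<rho> N) (\<lambda>\<xi>. tv \<nu> (empirical N \<xi>)) - 0) < e"
  proof (intro exI[of _ "max 2 N0"] allI impI)
    fix N assume "max 2 N0 \<le> N"
    then have N: "2 \<le> N" "N0 \<le> N" by auto
    let ?E = "expect (\<rho> N) (\<lambda>\<xi>. tv \<nu> (empirical N \<xi>))"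
    have "g * ?E < 3 * \<eta>"
      using invariant_tv_le[OF A(1) \<epsilon>(1) N(1) S[OF N(1)] \<rho>[OF N(1)] \<nu>] \<epsilon>(2) \<nu>A N0[OF N(2)]
      unfolding g_def by linarith
    also have "\<dots> < g * e" using g e by (simp add: \<eta>_def)
    finally have "?E < e" using g by simp
    moreover have "0 \<le> ?E" by (rule Bochner_Integration.integral_nonneg) (simp add: tv_nonneg)
    ultimately show "norm (?E - 0) < e" by simp
  qed
qed

lemma mean_square_occupation_tendsto_0:
  assumes lim: "(\<lambda>N. expect (\<rho> N) (\<lambda>\<xi>. tv \<nu> (empirical N \<xi>))) \<longlonglongrightarrow> 0"
  shows "(\<lambda>N. expect (\<rho> N) (\<lambda>\<xi>. (real (occupation N \<xi> x) / real N - pmf \<nu> x)\<^sup>2)) \<longlonglongrightarrow> 0"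
proof (rule tendsto_sandwich[OF _ _ tendsto_const lim])
  show "\<forall>\<^sub>F N in sequentially. 0 \<le> expect (\<rho> N) (\<lambda>\<xi>. (real (occupation N \<xi> x) / real N - pmf \<nu> x)\<^sup>2)"
    by (intro always_eventually allI Bochner_Integration.integral_nonneg) simp
  have "expect (\<rho> N) (\<lambda>\<xi>. (real (occupation N \<xi> x) / real N - pmf \<nu> x)\<^sup>2)
      \<le> expect (\<rho> N) (\<lambda>\<xi>. tv \<nu> (empirical N \<xi>))" if "0 < N" for N
  proof -
    have sq: "(real (occupation N \<xi> x) / real N - pmf \<nu> x)\<^sup>2 \<le> tv \<nu> (empirical N \<xi>)" for \<xi>
    proof -
      let ?d = "pmf \<nu> x - pmf (empirical N \<xi>) x"
      have d: "\<bar>?d\<bar> \<le> tv \<nu> (empirical N \<xi>)" by (rule abs_pmf_diff_le_tv)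
      moreover have "\<bar>?d\<bar> * \<bar>?d\<bar> \<le> \<bar>?d\<bar> * 1"
        by (intro mult_left_mono order_trans[OF d tv_le_1]) simp
      moreover have "(real (occupation N \<xi> x) / real N - pmf \<nu> x)\<^sup>2 = \<bar>?d\<bar> * \<bar>?d\<bar>"
        using \<open>0 < N\<close> by (simp add: pmf_empirical power2_eq_square algebra_simps)
      ultimately show ?thesis using order_trans by fastforce
    qed
    show ?thesis
      using sq order_trans[OF sq tv_le_1]
      by (intro integral_mono integrable_pmf_bounded[where B = 1]) (auto simp: tv_nonneg tv_le_1)
  qed
  then show "\<forall>\<^sub>F N in sequentially. expect (\<rho> N) (\<lambda>\<xi>. (real (occupation N \<xi> x) / real N - pmf \<nu> x)\<^sup>2)
      \<le> expect (\<rho> N) (\<lambda>\<xi>. tv \<nu> (empirical N \<xi>))"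
    by (auto simp: eventually_sequentially intro!: exI[of _ 1])
qed

end

theorem theorem1p4:
  fixes L :: "'s set" and \<Delta> :: 's
    and q :: "'s \<Rightarrow> 's \<Rightarrow> real"
    and P :: "real \<Rightarrow> 's \<Rightarrow> 's pmf"
    and M :: "'s \<Rightarrow> 'w measure" and Z :: "real \<Rightarrow> 'w \<Rightarrow> 's"
    and S :: "nat \<Rightarrow> real \<Rightarrow> (nat \<Rightarrow> 's) \<Rightarrow> (nat \<Rightarrow> 's) pmf"
    and \<rho> :: "nat \<Rightarrow> (nat \<Rightarrow> 's) pmf"
  assumes "countable L" and "\<Delta> \<notin> L"
    and "rate_matrix (insert \<Delta> L) q"
    and "\<forall>x\<in>L. q \<Delta> x = 0"
    and "jump_markov_process (insert \<Delta> L) P M Z"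
    and "has_transition_rates (insert \<Delta> L) P q"
    and "max_exit_rate L \<Delta> q < \<infinity>"
    and "\<forall>x\<in>L. \<forall>y\<in>L. \<forall>t>0. 0 < pmf (P t x) y"
    and "\<forall>x\<in>insert \<Delta> L. AE \<omega> in M x. absorption_time Z \<Delta> \<omega> < \<infinity>"
    and "ergodicity_coeff L q > max_absorbing_rate L \<Delta> q"
    and "\<forall>N\<ge>2. fv_semigroup L \<Delta> q N (S N)"
    and "\<forall>N\<ge>2. invariant_law (configs L N) (S N) (\<rho> N)"
  shows "\<exists>\<nu> :: 's pmf. set_pmf \<nu> \<subseteq> L \<and>
      (\<forall>x\<in>L. (\<lambda>N. measure_pmf.expectation (\<rho> N)
          (\<lambda>\<xi>. (real (occupation N \<xi> x) / real N - pmf \<nu> x)\<^sup>2)) \<longlonglongrightarrow> 0) \<and>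
      quasi_stationary L \<Delta> P \<nu> \<and>
      (\<forall>\<nu>'. quasi_stationary L \<Delta> P \<nu>' \<longrightarrow> \<nu>' = \<nu>)"
proof -
  define K where "K = enn2real (max_exit_rate L \<Delta> q)"
  define C where "C = enn2real (max_absorbing_rate L \<Delta> q)"
  have "max_absorbing_rate L \<Delta> q < top"
    using assms(10) less_top_ennreal order_less_le_trans top_greatest by blast
  then have C: "ennreal C = max_absorbing_rate L \<Delta> q" "0 \<le> C" by (simp_all add: C_def)
  have nonneg: "0 \<le> q x y" if "x \<in> L" "y \<in> insert \<Delta> L" "x \<noteq> y" for x y
    using assms(3) that by (auto simp: rate_matrix_def)
  obtain F a where F: "finite F" "F \<subseteq> L" "\<And>z. 0 \<le> a z"
    "\<And>x z. x \<in> L \<Longrightarrow> z \<in> F \<Longrightarrow> x \<noteq> z \<Longrightarrow> a z \<le> q x z" "C < sum a F"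
    using finite_minorant[of C L q] assms(10) C nonneg by auto
  have kill: "q x \<Delta> \<le> C" if "x \<in> L" for x
  proof -
    have "ennreal (q x \<Delta>) \<le> ennreal C"
      unfolding C(1) max_absorbing_rate_def using that by (rule SUP_upper)
    then show ?thesis using C(2) by (simp add: ennreal_le_iff)
  qed
  interpret absorbed_process L \<Delta> q K C F a P
  proof
    show "L \<noteq> {}" using F(2,5) C(2) by auto
    show "- q x x \<le> K" if "x \<in> L" for x
      unfolding K_def by (rule exit_rates_bounded[OF assms(3,7) that])
    show "markov_semigroup (insert \<Delta> L) P" using assms(5) by (simp add: jump_markov_process_def)
  qed (use assms F kill in auto)
  obtain \<nu> where \<nu>: "set_pmf \<nu> \<subseteq> L" "reinject \<nu> = \<nu>"
    using reinject_fixed_exists by blast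
  have "(\<lambda>N. expect (\<rho> N) (\<lambda>\<xi>. tv \<nu> (empirical N \<xi>))) \<longlonglongrightarrow> 0"
    using assms(11,12) by (intro invariant_tv_tendsto_0[of S] \<nu>) auto
  note square = mean_square_occupation_tendsto_0[OF this]
  have unique: "\<nu>' = \<nu>" if "quasi_stationary L \<Delta> P \<nu>'" for \<nu>'
    by (rule reinject_fixed_unique[OF _ \<nu>(1) quasi_stationary_imp_reinject_fixed[OF that] \<nu>(2)])
      (use that in \<open>simp add: quasi_stationary_def\<close>)
  show ?thesis
    by (intro exI[of _ \<nu>] conjI ballI allI impI \<nu>(1) square unique
        reinject_fixed_imp_quasi_stationary[OF \<nu>])
qed

end
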